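(* For every real $p \ge 1$ with $p \ne 2$ there exists a positive constant $C_p$, depending on $p$ alone, such that the following holds. Let $n \ge 1$, $\theta^* \in \mathcal{I} = \{\theta \in \mathbb{R}^n : \theta_1 \le \dots \le \theta_n\}$, and $Y = \theta^* + \varepsilon$ where $\varepsilon_1, \dots, \varepsilon_n$ are i.i.d. $N(0,\sigma^2)$. Let $\hat\theta$ be the isotonic least squares estimator, i.e. the projection of $Y$ onto $\mathcal{I}$. Let $k$ denote the number of constant blocks of $\theta^*$ and let $n_1, \dots, n_k$ denote the lengths of these blocks. Then $$R^{(p)}(\hat\theta,\theta^* ) \le C_p \frac{\sigma^p}{n} \sum_{i=1}^k n_i^{(2-p)_+/2} \le C_p\, \sigma^p \left(\frac{k}{n}\right)^{\min(p,2)/2}.$$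
   Context: $\mathcal{I} := \{(\theta_1,\dots,\theta_n) \in \mathbb{R}^n : \theta_1 \le \dots \le \theta_n\}$, and the isotonic least squares estimator is $\hat\theta := \arg\min_{\theta \in \mathcal{I}} \|Y - \theta\|^2$, with $\|\cdot\|$ the Euclidean norm (it exists and is unique). For $p \ge 1$ the $\ell_p$-risk is $R^{(p)}(\hat\theta,\theta^* ) := \frac{1}{n}\mathbb{E}\sum_{i=1}^n |\hat\theta_i - \theta_i^*|^p$. The constant blocks of $\theta^* \in \mathcal{I}$ are the maximal sets of consecutive indices on which $\theta^*$ is constant; so $k-1$ is the number of $i \in \{1,\dots,n-1\}$ with $\theta^*_i < \theta^*_{i+1}$, and $n_1 + \dots + n_k = n$. Also $x_+ := \max(x,0)$. *)

theory Defs
  imports "HOL-Probability.Probability"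
begin

text \<open>Vectors in \<open>\<real>\<^sup>n\<close> are the extensional functions \<open>{1..n} \<rightarrow>\<^sub>E UNIV\<close>: \<open>n\<close> has to be
  quantified inside the theorem, after the constant. Extensionality makes the minimiser below unique.\<close>

definition isotone_cone :: "nat \<Rightarrow> (nat \<Rightarrow> real) set" where
  "isotone_cone n = {\<theta> \<in> {1..n} \<rightarrow>\<^sub>E UNIV. mono_on {1..n} \<theta>}"

definition isotonic_lse :: "nat \<Rightarrow> (nat \<Rightarrow> real) \<Rightarrow> (nat \<Rightarrow> real)" where
  "isotonic_lse n Y = arg_min_on (\<lambda>\<theta>. \<Sum>i=1..n. (Y i - \<theta> i)\<^sup>2) (isotone_cone n)"

definition gaussian_noise :: "nat \<Rightarrow> real \<Rightarrow> (nat \<Rightarrow> real) measure" where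
  "gaussian_noise n \<sigma> = (\<Pi>\<^sub>M i\<in>{1..n}. density lborel (normal_density 0 \<sigma>))"

text \<open>The expectation of a nonnegative variable is taken in \<open>[0, \<infinity>]\<close>, because the Bochner integral
  would silently be 0 if the loss were not integrable. The risk depends only on the law of the
  noise, so it is defined on the canonical sample space; \<open>isotonic_risk_eq_expectation\<close> below shows
  that i.i.d. Gaussian noise on any probability space gives the same value.\<close>

definition isotonic_risk :: "real \<Rightarrow> nat \<Rightarrow> real \<Rightarrow> (nat \<Rightarrow> real) \<Rightarrow> ennreal" where
  "isotonic_risk p n \<sigma> \<theta> = ennreal (1 / real n) *
     (\<integral>\<^sup>+ \<epsilon>. ennreal (\<Sum>i=1..n. \<bar>isotonic_lse n (\<lambda>j\<in>{1..n}. \<theta> j + \<epsilon> j) i - \<theta> i\<bar> powr p)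
       \<partial>gaussian_noise n \<sigma>)"

definition constant_run :: "nat \<Rightarrow> (nat \<Rightarrow> real) \<Rightarrow> nat set \<Rightarrow> bool" where
  "constant_run n \<theta> B \<longleftrightarrow>
     (\<exists>a b. 1 \<le> a \<and> a \<le> b \<and> b \<le> n \<and> B = {a..b}) \<and> (\<forall>i\<in>B. \<forall>j\<in>B. \<theta> i = \<theta> j)"

definition constant_blocks :: "nat \<Rightarrow> (nat \<Rightarrow> real) \<Rightarrow> nat set set" where
  "constant_blocks n \<theta> =
     {B. constant_run n \<theta> B \<and> (\<forall>B'. constant_run n \<theta> B' \<and> B \<subseteq> B' \<longrightarrow> B' = B)}"

lemma isotone_coneD:
  assumes "u \<in> isotone_cone n" "i \<in> {1..n}" "j \<in> {1..n}" "i \<le> j"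
  shows "u i \<le> u j"
  using assms by (auto simp: isotone_cone_def mono_on_def)

lemma isotone_cone_convex_comb:
  assumes "u \<in> isotone_cone n" "v \<in> isotone_cone n" "0 \<le> t" "t \<le> 1"
  shows "(\<lambda>i\<in>{1..n}. u i + t * (v i - u i)) \<in> isotone_cone n"
proof -
  have "u i + t * (v i - u i) \<le> u j + t * (v j - u j)"
    if "i \<in> {1..n}" "j \<in> {1..n}" "i \<le> j" for i j
  proof -
    have "(1 - t) * u i + t * v i \<le> (1 - t) * u j + t * v j"
      using isotone_coneD[OF assms(1) that] isotone_coneD[OF assms(2) that] assms(3,4)
      by (intro add_mono mult_left_mono) auto
    then show ?thesis by (simp add: algebra_simps)
  qed
  then show ?thesis by (auto simp: isotone_cone_def mono_on_def)
qed

lemma isotonic_lse_exists: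
  "\<exists>u\<in>isotone_cone n. \<forall>v\<in>isotone_cone n. (\<Sum>i=1..n. (Y i - u i)\<^sup>2) \<le> (\<Sum>i=1..n. (Y i - v i)\<^sup>2)"
proof -
  let ?f = "\<lambda>\<theta>. \<Sum>i=1..n. (Y i - \<theta> i :: real)\<^sup>2"
  define R where "R = (\<Sum>i=1..n. \<bar>Y i\<bar>) + sqrt (\<Sum>i=1..n. (Y i)\<^sup>2)"
  define K where "K = {\<theta>. \<forall>i. \<theta> i \<in> (if i \<in> {1..n} then {-R..R} else {undefined})}
    \<inter> (\<Inter>i\<in>{1..n}. \<Inter>j\<in>{i..n}. {\<theta>. (\<theta> i :: real) \<le> \<theta> j})"
  define z :: "nat \<Rightarrow> real" where "z = (\<lambda>i\<in>{1..n}. 0)"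
  have R0: "0 \<le> R" unfolding R_def by (intro add_nonneg_nonneg sum_nonneg real_sqrt_ge_zero) auto
  have cone_K: "\<theta> \<in> K \<longleftrightarrow> \<theta> \<in> isotone_cone n \<and> (\<forall>i\<in>{1..n}. \<bar>\<theta> i\<bar> \<le> R)" for \<theta>
    unfolding K_def isotone_cone_def mono_on_def
    by (auto simp: PiE_def extensional_def abs_le_iff minus_le_iff split: if_splits)
  have cont: "continuous_on A (\<lambda>\<theta>::nat \<Rightarrow> real. \<theta> i)" for A i
    by (rule continuous_on_subset[OF continuous_on_product_coordinates]) auto
  have "compact (PiE UNIV (\<lambda>i. if i \<in> {1..n} then {-R..R} else {undefined :: real}))"
    unfolding compactin_euclidean_iff[symmetric] euclidean_product_topology[symmetric] compactin_PiE
    by simp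
  moreover have "closed (\<Inter>i\<in>{1..n}. \<Inter>j\<in>{i..n}. {\<theta>. (\<theta> i :: real) \<le> \<theta> j})"
    by (intro closed_INT ballI closed_Collect_le cont)
  ultimately have "compact K"
    unfolding K_def by (intro compact_Int_closed) (auto simp: PiE_def Pi_def)
  moreover have zK: "z \<in> K"
    unfolding cone_K using R0 by (auto simp: z_def isotone_cone_def mono_on_def)
  moreover have "continuous_on K ?f" by (intro continuous_intros cont)
  ultimately obtain u where u: "u \<in> K" "\<And>v. v \<in> K \<Longrightarrow> ?f u \<le> ?f v"
    using continuous_attains_inf[of K ?f] by blast
  have "?f u \<le> ?f v" if v: "v \<in> isotone_cone n" for v
  proof (cases "v \<in> K")
    case False
    then obtain i where i: "i \<in> {1..n}" "\<bar>v i\<bar> > R" using v cone_K by auto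
    have "\<bar>Y i\<bar> \<le> (\<Sum>i=1..n. \<bar>Y i\<bar>)" by (rule member_le_sum) (use i in auto)
    then have "sqrt (\<Sum>i=1..n. (Y i)\<^sup>2) \<le> \<bar>Y i - v i\<bar>" using i unfolding R_def by linarith
    then have "(\<Sum>i=1..n. (Y i)\<^sup>2) \<le> (Y i - v i)\<^sup>2"
      using sqrt_le_D[of _ "\<bar>Y i - v i\<bar>"] by simp
    also have "\<dots> \<le> ?f v" by (rule member_le_sum) (use i in auto)
    finally have "?f z \<le> ?f v" by (simp add: z_def)
    then show ?thesis using u(2)[OF zK] by linarith
  qed (use u in auto)
  then show ?thesis using u cone_K by blast
qed

lemma isotonic_lse_properties:
  shows isotonic_lse_in_cone: "isotonic_lse n Y \<in> isotone_cone n"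
    and isotonic_lse_minimal: "\<And>v. v \<in> isotone_cone n \<Longrightarrow>
      (\<Sum>i=1..n. (Y i - isotonic_lse n Y i)\<^sup>2) \<le> (\<Sum>i=1..n. (Y i - v i)\<^sup>2)"
proof -
  let ?f = "\<lambda>\<theta>. \<Sum>i=1..n. (Y i - \<theta> i :: real)\<^sup>2"
  have "\<exists>u. is_arg_min ?f (\<lambda>\<theta>. \<theta> \<in> isotone_cone n) u"
    using isotonic_lse_exists[of n Y] unfolding is_arg_min_linorder by blast
  then have "is_arg_min ?f (\<lambda>\<theta>. \<theta> \<in> isotone_cone n) (isotonic_lse n Y)"
    unfolding isotonic_lse_def arg_min_on_def arg_min_def by (rule someI_ex)
  then show "isotonic_lse n Y \<in> isotone_cone n"
    "\<And>v. v \<in> isotone_cone n \<Longrightarrow> ?f (isotonic_lse n Y) \<le> ?f v"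
    unfolding is_arg_min_linorder by blast+
qed

lemma isotonic_lse_variational:
  assumes u: "u \<in> isotone_cone n"
    and min: "\<And>v. v \<in> isotone_cone n \<Longrightarrow> (\<Sum>i=1..n. (Y i - u i)\<^sup>2) \<le> (\<Sum>i=1..n. (Y i - v i)\<^sup>2)"
    and v: "v \<in> isotone_cone n"
  shows "(\<Sum>i=1..n. (Y i - u i) * (v i - u i)) \<le> 0"
proof (rule ccontr)
  define a where "a = (\<Sum>i=1..n. (Y i - u i) * (v i - u i))"
  define b where "b = (\<Sum>i=1..n. (v i - u i)\<^sup>2)"
  assume "\<not> ?thesis"
  then have a: "a > 0" by (simp add: a_def)
  have b: "b \<ge> 0" unfolding b_def by (intro sum_nonneg) auto
  define t where "t = a / (a + b)"
  have t: "0 < t" "t \<le> 1" using a b by (auto simp: t_def)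
  have "(\<Sum>i=1..n. (Y i - u i)\<^sup>2) \<le> (\<Sum>i=1..n. (Y i - (\<lambda>i\<in>{1..n}. u i + t * (v i - u i)) i)\<^sup>2)"
    by (rule min[OF isotone_cone_convex_comb]) (use u v t in auto)
  also have "\<dots> = (\<Sum>i=1..n. (Y i - u i)\<^sup>2 - 2 * t * ((Y i - u i) * (v i - u i)) + t\<^sup>2 * (v i - u i)\<^sup>2)"
    by (intro sum.cong) (auto simp: power2_eq_square algebra_simps)
  also have "\<dots> = (\<Sum>i=1..n. (Y i - u i)\<^sup>2) - 2 * t * a + t\<^sup>2 * b"
    by (simp add: sum.distrib sum_subtractf sum_distrib_left a_def b_def)
  finally have "t * (2 * a) \<le> t * (t * b)" by (simp add: power2_eq_square)
  then have "2 * a \<le> t * b" using t(1) by simp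
  moreover have "t * b \<le> a"
  proof -
    have "a * b \<le> a * (a + b)" using a b by (intro mult_left_mono) auto
    then show ?thesis using a b by (simp add: t_def field_simps)
  qed
  ultimately show False using a by simp
qed

lemma isotonic_lse_unique:
  assumes u: "u \<in> isotone_cone n"
    and min: "\<And>v. v \<in> isotone_cone n \<Longrightarrow> (\<Sum>i=1..n. (Y i - u i)\<^sup>2) \<le> (\<Sum>i=1..n. (Y i - v i)\<^sup>2)"
  shows "isotonic_lse n Y = u"
proof -
  let ?w = "isotonic_lse n Y"
  have "(\<Sum>i=1..n. (Y i - u i) * (?w i - u i)) + (\<Sum>i=1..n. (Y i - ?w i) * (u i - ?w i)) \<le> 0"
    using isotonic_lse_variational[OF u min isotonic_lse_in_cone]
      isotonic_lse_variational[OF isotonic_lse_in_cone isotonic_lse_minimal u]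
    by (intro add_nonpos_nonpos)
  also have "(\<Sum>i=1..n. (Y i - u i) * (?w i - u i)) + (\<Sum>i=1..n. (Y i - ?w i) * (u i - ?w i))
      = (\<Sum>i=1..n. (?w i - u i)\<^sup>2)"
    unfolding sum.distrib[symmetric]
    by (intro sum.cong) (auto simp: power2_eq_square algebra_simps)
  finally have "(\<Sum>i=1..n. (?w i - u i)\<^sup>2) = 0"
    by (intro antisym sum_nonneg) auto
  then have eq: "\<forall>i\<in>{1..n}. ?w i = u i"
    by (subst (asm) sum_nonneg_eq_0_iff) auto
  show ?thesis
  proof (rule PiE_ext[of _ "{1..n}" "\<lambda>_. UNIV"])
    show "?w \<in> {1..n} \<rightarrow>\<^sub>E UNIV" "u \<in> {1..n} \<rightarrow>\<^sub>E UNIV"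
      using u isotonic_lse_in_cone[of n Y] by (auto simp: isotone_cone_def)
  qed (use eq in auto)
qed

lemma isotonic_lse_cong:
  assumes "\<And>i. i \<in> {1..n} \<Longrightarrow> Y i = Y' i"
  shows "isotonic_lse n Y = isotonic_lse n Y'"
proof -
  have "(\<lambda>\<theta>. \<Sum>i=1..n. (Y i - \<theta> i)\<^sup>2) = (\<lambda>\<theta>. \<Sum>i=1..n. (Y' i - \<theta> i)\<^sup>2)"
    by (intro ext sum.cong) (use assms in auto)
  then show ?thesis by (simp only: isotonic_lse_def)
qed

lemma isotonic_lse_nonexpansive:
  "(\<Sum>i=1..n. (isotonic_lse n Y i - isotonic_lse n Y' i)\<^sup>2) \<le> (\<Sum>i=1..n. (Y i - Y' i)\<^sup>2)"
proof -
  let ?u = "isotonic_lse n Y" and ?u' = "isotonic_lse n Y'"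
  have "(\<Sum>i=1..n. (Y i - ?u i) * (?u' i - ?u i)) + (\<Sum>i=1..n. (Y' i - ?u' i) * (?u i - ?u' i)) \<le> 0"
    by (intro add_nonpos_nonpos isotonic_lse_variational isotonic_lse_in_cone isotonic_lse_minimal)
  then have "0 \<le> (\<Sum>i=1..n. - 2 * ((Y i - ?u i) * (?u' i - ?u i) + (Y' i - ?u' i) * (?u i - ?u' i)))"
    unfolding sum_distrib_left[symmetric] sum.distrib by simp
  also have "\<dots> \<le> (\<Sum>i=1..n. (Y i - Y' i)\<^sup>2 - (?u i - ?u' i)\<^sup>2)"
  proof (rule sum_mono)
    fix i
    have "0 \<le> ((Y i - Y' i) - (?u i - ?u' i))\<^sup>2" by simp
    then show "- 2 * ((Y i - ?u i) * (?u' i - ?u i) + (Y' i - ?u' i) * (?u i - ?u' i))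
        \<le> (Y i - Y' i)\<^sup>2 - (?u i - ?u' i)\<^sup>2"
      by (simp add: power2_eq_square algebra_simps)
  qed
  finally show ?thesis by (simp add: sum_subtractf)
qed

lemma measurable_isotonic_lse:
  assumes i: "i \<in> {1..n}"
  shows "(\<lambda>Y. isotonic_lse n Y i) \<in> borel_measurable (\<Pi>\<^sub>M j\<in>{1..n}. borel)"
proof -
  let ?g = "\<lambda>Y. isotonic_lse n Y i"
  have bound: "\<bar>?g Y' - ?g Y\<bar> \<le> sqrt (\<Sum>i=1..n. (Y' i - Y i)\<^sup>2)" for Y Y'
  proof -
    have "(?g Y' - ?g Y)\<^sup>2 \<le> (\<Sum>i=1..n. (isotonic_lse n Y' i - isotonic_lse n Y i)\<^sup>2)"
      by (rule member_le_sum) (use i in auto)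
    also have "\<dots> \<le> (\<Sum>i=1..n. (Y' i - Y i)\<^sup>2)" by (rule isotonic_lse_nonexpansive)
    finally show ?thesis by (simp add: real_le_rsqrt)
  qed
  have "isCont ?g Y" for Y
  proof -
    have coord: "((\<lambda>Y'. Y' j) \<longlongrightarrow> Y j) (at Y)" for j
      using continuous_on_product_coordinates[of j, where 'b = real]
      unfolding continuous_on_eq_continuous_at[OF open_UNIV] isCont_def by blast
    have "((\<lambda>Y'. sqrt (\<Sum>i=1..n. (Y' i - Y i)\<^sup>2)) \<longlongrightarrow> sqrt (\<Sum>i=1..n. (Y i - Y i)\<^sup>2)) (at Y)"
      by (intro tendsto_intros coord)
    then have "((\<lambda>Y'. sqrt (\<Sum>i=1..n. (Y' i - Y i)\<^sup>2)) \<longlongrightarrow> 0) (at Y)" by simp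
    then have "((\<lambda>Y'. ?g Y' - ?g Y) \<longlongrightarrow> 0) (at Y)"
      by (rule Lim_null_comparison[rotated]) (use bound in auto)
    then show ?thesis unfolding isCont_def by (rule LIM_zero_cancel)
  qed
  then have "?g \<in> borel_measurable borel"
    by (intro borel_measurable_continuous_onI) (simp add: continuous_on_eq_continuous_at)
  then have g: "?g \<in> borel_measurable (\<Pi>\<^sub>M j\<in>(UNIV::nat set). borel)"
    by (simp cong: measurable_cong_sets add: sets_PiM_equal_borel)
  have "(\<lambda>Y j. if j \<in> {1..n} then Y j else 0)
      \<in> (\<Pi>\<^sub>M j\<in>{1..n}. borel) \<rightarrow>\<^sub>M (\<Pi>\<^sub>M j\<in>(UNIV::nat set). (borel :: real measure))"
  proof (rule measurable_PiM_single')
    fix j :: nat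
    show "(\<lambda>Y. if j \<in> {1..n} then Y j else 0) \<in> borel_measurable (\<Pi>\<^sub>M j\<in>{1..n}. borel)"
      by (cases "j \<in> {1..n}") auto
  qed auto
  from measurable_compose[OF this g]
  have "(\<lambda>Y. isotonic_lse n (\<lambda>j. if j \<in> {1..n} then Y j else 0) i)
      \<in> borel_measurable (\<Pi>\<^sub>M j\<in>{1..n}. borel)" .
  moreover have "isotonic_lse n (\<lambda>j. if j \<in> {1..n} then Y j else 0) = isotonic_lse n Y" for Y
    by (rule isotonic_lse_cong) auto
  ultimately show ?thesis by simp
qed

theorem isotonic_risk_eq_expectation:
  fixes M :: "'a measure" and \<epsilon> :: "nat \<Rightarrow> 'a \<Rightarrow> real"
  assumes "prob_space M" and n: "1 \<le> n"
    and indep: "prob_space.indep_vars M (\<lambda>_. borel) \<epsilon> {1..n}"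
    and normal: "\<And>i. i \<in> {1..n} \<Longrightarrow> distributed M lborel (\<epsilon> i) (normal_density 0 \<sigma>)"
  shows "isotonic_risk p n \<sigma> \<theta> = ennreal (1 / real n) *
    (\<integral>\<^sup>+ \<omega>. ennreal (\<Sum>i=1..n. \<bar>isotonic_lse n (\<lambda>j\<in>{1..n}. \<theta> j + \<epsilon> j \<omega>) i - \<theta> i\<bar> powr p) \<partial>M)"
proof -
  interpret prob_space M by fact
  let ?P = "\<Pi>\<^sub>M j\<in>{1..n}. (borel :: real measure)"
  let ?F = "\<lambda>e. ennreal (\<Sum>i=1..n. \<bar>isotonic_lse n (\<lambda>j\<in>{1..n}. \<theta> j + e j) i - \<theta> i\<bar> powr p)"
  have rv: "\<epsilon> i \<in> borel_measurable M" if "i \<in> {1..n}" for i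
    using indep that by (auto simp: indep_vars_def)
  have shift: "(\<lambda>e. \<lambda>j\<in>{1..n}. \<theta> j + e j) \<in> ?P \<rightarrow>\<^sub>M ?P" by measurable
  have F: "?F \<in> borel_measurable ?P"
    by (intro measurable_compose[OF _ measurable_ennreal] borel_measurable_sum powr_real_measurable
        borel_measurable_abs borel_measurable_diff measurable_compose[OF shift measurable_isotonic_lse]) auto
  have vec: "(\<lambda>\<omega>. \<lambda>i\<in>{1..n}. \<epsilon> i \<omega>) \<in> M \<rightarrow>\<^sub>M ?P" using rv by measurable
  have "distr M ?P (\<lambda>\<omega>. \<lambda>i\<in>{1..n}. \<epsilon> i \<omega>) = (\<Pi>\<^sub>M i\<in>{1..n}. distr M borel (\<epsilon> i))"
    using indep_vars_iff_distr_eq_PiM'[of "{1..n}" \<epsilon> "\<lambda>_. borel"] indep rv n by auto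
  also have "\<dots> = gaussian_noise n \<sigma>"
    unfolding gaussian_noise_def
  proof (rule PiM_cong)
    fix i assume "i \<in> {1..n}"
    then have "distr M lborel (\<epsilon> i) = density lborel (normal_density 0 \<sigma>)"
      using normal by (simp add: distributed_def)
    moreover have "distr M lborel (\<epsilon> i) = distr M borel (\<epsilon> i)" by (rule distr_cong) auto
    ultimately show "distr M borel (\<epsilon> i) = density lborel (normal_density 0 \<sigma>)" by simp
  qed simp
  finally have law: "gaussian_noise n \<sigma> = distr M ?P (\<lambda>\<omega>. \<lambda>i\<in>{1..n}. \<epsilon> i \<omega>)" by simp
  have "(\<integral>\<^sup>+ e. ?F e \<partial>gaussian_noise n \<sigma>) = (\<integral>\<^sup>+ \<omega>. ?F (\<lambda>i\<in>{1..n}. \<epsilon> i \<omega>) \<partial>M)"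
    unfolding law by (rule nn_integral_distr[OF vec]) (use F in simp)
  also have "\<dots> = (\<integral>\<^sup>+ \<omega>. ?F (\<lambda>i. \<epsilon> i \<omega>) \<partial>M)"
    by (simp cong: restrict_cong)
  finally show ?thesis by (simp add: isotonic_risk_def)
qed

end

theory Submission
  imports Defs
begin

text \<open>
  If \<open>i\<close> lies in a constant block \<open>{a..b}\<close> of \<open>\<theta>\<close>, then lowering the estimator on \<open>{u..b}\<close>, where \<open>u\<close>
  is the first index of its level set at \<open>i\<close>, shows that its value at \<open>i\<close> is at most the average of
  \<open>Y\<close> over \<open>{u..b}\<close>. As \<open>\<theta> \<le> \<theta> i\<close> there, the positive part of the error is at most an average of
  the noise over at least \<open>b + 1 - i\<close> consecutive indices ending at \<open>b\<close>; symmetrically, the negative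
  part is controlled by averages of at least \<open>i + 1 - a\<close> terms starting at \<open>a\<close>. The maximal average
  over all lengths \<open>\<ge> m\<close> has \<open>p\<close>-th moment of order \<open>\<sigma> powr p * m powr (- p / 2)\<close>, and summing this
  over a block of length \<open>N\<close> gives \<open>N powr (max (2 - p) 0 / 2)\<close>, since \<open>p \<noteq> 2\<close>.

  The maximal inequality needs no martingales: even moments of order \<open>2 * r \<ge> 4\<close> of the partial sums
  are compared along a dyadic chain.
\<close>

subsection \<open>One-sided averages\<close>

lemma restrict_in_isotone_cone:
  assumes "\<And>i j. 1 \<le> i \<Longrightarrow> i \<le> j \<Longrightarrow> j \<le> n \<Longrightarrow> f i \<le> f j"
  shows "restrict f {1..n} \<in> isotone_cone n"
  using assms by (auto simp: isotone_cone_def mono_on_def)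

text \<open>The variational inequality, tested against the estimator shifted by \<open>d\<close> on
  \<open>A\<close>: the direction vanishes off \<open>A\<close>, so only these coordinates survive.
  Both signs of \<open>d\<close> are used below.\<close>

lemma isotonic_lse_perturb:
  assumes A: "A \<subseteq> {1..n}"
    and cone: "(\<lambda>j\<in>{1..n}. isotonic_lse n Y j + (if j \<in> A then d else 0)) \<in> isotone_cone n"
  shows "d * (\<Sum>j\<in>A. Y j - isotonic_lse n Y j) \<le> 0"
proof -
  let ?w = "isotonic_lse n Y"
  have "d * (\<Sum>j\<in>A. Y j - ?w j) = (\<Sum>j\<in>{1..n}. if j \<in> A then d * (Y j - ?w j) else 0)"
    using A by (simp add: sum_distrib_left sum.If_cases Int_absorb1)
  also have "\<dots> = (\<Sum>j=1..n. (Y j - ?w j) *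
      ((\<lambda>j\<in>{1..n}. ?w j + (if j \<in> A then d else 0)) j - ?w j))"
    by (intro sum.cong) auto
  also have "\<dots> \<le> 0"
    by (rule isotonic_lse_variational[OF isotonic_lse_in_cone isotonic_lse_minimal cone])
  finally show ?thesis .
qed

text \<open>The estimator jumps strictly at the left end \<open>u\<close> of its level set through
  \<open>i\<close>, so it can be lowered on \<open>{u..b}\<close> without leaving the cone.
  Optimality then makes its sum over \<open>{u..b}\<close> at most that of \<open>Y\<close>, while
  monotonicity makes this sum at least \<open>b + 1 - u\<close> times the value at
  \<open>i\<close>.\<close>

lemma isotonic_lse_le_average:
  assumes i: "1 \<le> i" "i \<le> b" "b \<le> n"
  shows "\<exists>u\<in>{1..i}. real (b + 1 - u) * isotonic_lse n Y i \<le> (\<Sum>j=u..b. Y j)"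
proof -
  let ?w = "isotonic_lse n Y"
  have mono: "?w j \<le> ?w k" if "1 \<le> j" "j \<le> k" "k \<le> n" for j k
    using isotone_coneD[OF isotonic_lse_in_cone, of j n k] that by auto
  \<comment> \<open>Index 0 has to be excluded: the estimator takes the default value
    \<open>undefined\<close> there, which might coincide with \<open>?w i\<close>.\<close>
  define u where "u = (LEAST u. 1 \<le> u \<and> ?w u = ?w i)"
  have u: "1 \<le> u" "?w u = ?w i" "u \<le> i"
    using LeastI[of "\<lambda>u. 1 \<le> u \<and> ?w u = ?w i" i] Least_le[of "\<lambda>u. 1 \<le> u \<and> ?w u = ?w i" i] i
    by (auto simp: u_def)
  have below: "?w j < ?w u" if "1 \<le> j" "j < u" for j
  proof -
    have "?w j \<noteq> ?w i" using not_less_Least[of j "\<lambda>u. 1 \<le> u \<and> ?w u = ?w i"] that by (auto simp: u_def)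
    then show ?thesis using mono[of j u] that u i by auto
  qed
  \<comment> \<open>The jump at \<open>u\<close> is what the lowering may use up. For
    \<open>u = 1\<close> there is no left neighbour, and any positive number serves.\<close>
  define d where "d = (if u = 1 then 1 else ?w u - ?w (u - 1))"
  have d: "d > 0" using below[of "u - 1"] u by (auto simp: d_def)
  have gap: "?w j + d \<le> ?w k" if "1 \<le> j" "j < u" "u \<le> k" "k \<le> n" for j k
  proof -
    have "?w j \<le> ?w (u - 1)" by (rule mono) (use that u i in linarith)+
    then show ?thesis using mono[of u k] that u by (simp add: d_def)
  qed
  have "(\<lambda>j\<in>{1..n}. ?w j + (if j \<in> {u..b} then - d else 0)) \<in> isotone_cone n"
  proof (rule restrict_in_isotone_cone)
    fix r s assume "1 \<le> r" "r \<le> s" "s \<le> n"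
    then show "?w r + (if r \<in> {u..b} then - d else 0) \<le> ?w s + (if s \<in> {u..b} then - d else 0)"
      using mono[of r s] gap[of r s] d by auto
  qed
  from isotonic_lse_perturb[OF _ this] have "- d * (\<Sum>j=u..b. Y j - ?w j) \<le> 0" using u i by simp
  then have "(\<Sum>j=u..b. ?w j) \<le> (\<Sum>j=u..b. Y j)" using d
    by (simp add: sum_subtractf zero_le_mult_iff)
  moreover have "(\<Sum>j=u..b. ?w i) \<le> (\<Sum>j=u..b. ?w j)"
    using mono[of u] u i by (intro sum_mono) auto
  ultimately show ?thesis using u by (intro bexI[of _ u]) auto
qed

text \<open>Mirror image of the previous argument: \<open>v\<close> is the last index of the level
  set through \<open>i\<close>, and the estimator is raised on \<open>{a..v}\<close> by the jump
  that follows \<open>v\<close>.\<close>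

lemma isotonic_lse_ge_average:
  assumes i: "1 \<le> a" "a \<le> i" "i \<le> n"
  shows "\<exists>v\<in>{i..n}. (\<Sum>j=a..v. Y j) \<le> real (v + 1 - a) * isotonic_lse n Y i"
proof -
  let ?w = "isotonic_lse n Y"
  have mono: "?w j \<le> ?w k" if "1 \<le> j" "j \<le> k" "k \<le> n" for j k
    using isotone_coneD[OF isotonic_lse_in_cone, of j n k] that by auto
  let ?P = "\<lambda>v. v \<le> n \<and> ?w v = ?w i"
  define v where "v = (GREATEST v. ?P v)"
  have v: "v \<le> n" "?w v = ?w i" "i \<le> v"
    using GreatestI_nat[of ?P i n] Greatest_le_nat[of ?P i n] i by (auto simp: v_def)
  have above: "?w v < ?w j" if "v < j" "j \<le> n" for j
  proof -
    have "?w j \<noteq> ?w i" using Greatest_le_nat[of ?P j n] that by (auto simp: v_def)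
    then show ?thesis using mono[of v j] that v i by auto
  qed
  define d where "d = (if v = n then 1 else ?w (v + 1) - ?w v)"
  have d: "d > 0" using above[of "v + 1"] v by (auto simp: d_def)
  have gap: "?w j + d \<le> ?w k" if "1 \<le> j" "j \<le> v" "v < k" "k \<le> n" for j k
  proof -
    have "?w (v + 1) \<le> ?w k" by (rule mono) (use that v i in linarith)+
    then show ?thesis using mono[of j v] that v by (simp add: d_def)
  qed
  have "(\<lambda>j\<in>{1..n}. ?w j + (if j \<in> {a..v} then d else 0)) \<in> isotone_cone n"
  proof (rule restrict_in_isotone_cone)
    fix r s assume "1 \<le> r" "r \<le> s" "s \<le> n"
    then show "?w r + (if r \<in> {a..v} then d else 0) \<le> ?w s + (if s \<in> {a..v} then d else 0)"
      using mono[of r s] gap[of r s] d by auto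
  qed
  from isotonic_lse_perturb[OF _ this] have "d * (\<Sum>j=a..v. Y j - ?w j) \<le> 0" using v i by simp
  then have "(\<Sum>j=a..v. Y j) \<le> (\<Sum>j=a..v. ?w j)" using d
    by (simp add: sum_subtractf mult_le_0_iff)
  moreover have "(\<Sum>j=a..v. ?w j) \<le> (\<Sum>j=a..v. ?w i)"
    using mono[of _ v] v i by (intro sum_mono) auto
  ultimately show ?thesis using v by (intro bexI[of _ v]) auto
qed

subsection \<open>A maximal inequality for averages\<close>

text \<open>The coefficient of the second term has to stay small, since it is multiplied up in the
  dyadic recursion below; the first term may carry any constant. Either \<open>x\<close> is small
  relative to \<open>y\<close> and \<open>x + y\<close> is hardly larger than \<open>y\<close>, or
  \<open>y\<close> is at most a fixed multiple of \<open>x\<close>.\<close>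

lemma power_add_le_mult_power:
  "\<exists>C\<ge>0. \<forall>x y::real. (x + y) ^ (2 * r) \<le> C * x ^ (2 * r) + 2 * y ^ (2 * r)"
proof (cases "r = 0")
  case True
  then show ?thesis by (intro exI[of _ 1]) auto
next
  case False
  \<comment> \<open>Chosen so that \<open>(1 + \<eta>) ^ (2 * r) = 2\<close>, which yields the
    coefficient 2.\<close>
  define \<eta> where "\<eta> = root (2 * r) 2 - 1"
  have \<eta>: "\<eta> > 0" "(1 + \<eta>) ^ (2 * r) = 2" using False by (auto simp: \<eta>_def)
  have "(x + y) ^ (2 * r) \<le> (1 + 1 / \<eta>) ^ (2 * r) * x ^ (2 * r) + 2 * y ^ (2 * r)" for x y :: real
  proof -
    have abs: "(x + y) ^ (2 * r) \<le> (\<bar>x\<bar> + \<bar>y\<bar>) ^ (2 * r)"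
      using power_mono[OF abs_triangle_ineq[of x y], of "2 * r"] by (simp add: power_even_abs)
    have nn: "0 \<le> x ^ (2 * r)" "0 \<le> y ^ (2 * r)" by (auto simp: power_mult)
    show ?thesis
    proof (cases "\<bar>x\<bar> \<le> \<eta> * \<bar>y\<bar>")
      case True
      then have "(\<bar>x\<bar> + \<bar>y\<bar>) ^ (2 * r) \<le> ((1 + \<eta>) * \<bar>y\<bar>) ^ (2 * r)"
        by (intro power_mono) (auto simp: algebra_simps)
      also have "\<dots> = 2 * y ^ (2 * r)" using \<eta> by (simp add: power_mult_distrib power_even_abs)
      finally show ?thesis using abs nn \<eta> by (smt (verit) mult_nonneg_nonneg zero_le_power divide_nonneg_nonneg)
    next
      case False
      then have "(\<bar>x\<bar> + \<bar>y\<bar>) ^ (2 * r) \<le> ((1 + 1 / \<eta>) * \<bar>x\<bar>) ^ (2 * r)"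
        using \<eta> by (intro power_mono) (auto simp: field_simps)
      also have "\<dots> = (1 + 1 / \<eta>) ^ (2 * r) * x ^ (2 * r)" by (simp add: power_mult_distrib power_even_abs)
      finally show ?thesis using abs nn by linarith
    qed
  qed
  then show ?thesis using \<eta> by (intro exI[of _ "(1 + 1 / \<eta>) ^ (2 * r)"]) auto
qed

text \<open>A majorant for the powers of all partial sums that start at \<open>a\<close> and have
  length at most \<open>2 ^ J\<close>. The recursion adds the bounds for the two halves instead of
  taking a maximum, so that its expectation follows from linearity; \<open>C\<close> and 2 are the
  coefficients of \<open>power_add_le_mult_power\<close>.\<close>

fun chain_bound :: "real \<Rightarrow> nat \<Rightarrow> (nat \<Rightarrow> real) \<Rightarrow> nat \<Rightarrow> nat \<Rightarrow> real" where
  "chain_bound C q x 0 a = x a ^ q"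
| "chain_bound C q x (Suc J) a =
     chain_bound C q x J a + 2 * chain_bound C q x J (a + 2 ^ J) + C * (\<Sum>t=a..<a + 2 ^ J. x t) ^ q"

lemma chain_bound_nonneg: "0 \<le> C \<Longrightarrow> even q \<Longrightarrow> 0 \<le> chain_bound C q x J a"
  by (induction J arbitrary: a) (auto intro!: add_nonneg_nonneg simp: zero_le_power_eq)

lemma measurable_chain_bound[measurable]:
  assumes [measurable]: "\<And>t. X t \<in> borel_measurable M"
  shows "(\<lambda>\<omega>. chain_bound C q (\<lambda>t. X t \<omega>) J a) \<in> borel_measurable M"
  by (induction J arbitrary: a) simp_all

text \<open>A sum of length at most \<open>2 ^ J\<close> is covered by the bound for the left half.
  A longer one is the full left half plus an initial piece of the right half, and the coefficient 2
  goes to the piece that is treated by recursion.\<close>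

lemma partial_sum_power_le_chain_bound:
  assumes C: "0 \<le> C" "\<And>x y::real. (x + y) ^ (2 * r) \<le> C * x ^ (2 * r) + 2 * y ^ (2 * r)" and r: "1 \<le> r"
  shows "l \<le> 2 ^ J \<Longrightarrow> (\<Sum>t=a..<a + l. x t) ^ (2 * r) \<le> chain_bound C (2 * r) x J a"
proof (induction J arbitrary: a l)
  case 0
  then consider "l = 0" | "l = 1" by fastforce
  then show ?case using r by cases (auto simp: zero_le_power_eq power_0_left)
next
  case (Suc J)
  have nn: "0 \<le> chain_bound C (2 * r) x J b" for b using C by (intro chain_bound_nonneg) auto
  have nn': "0 \<le> C * (\<Sum>t=a..<a + 2 ^ J. x t) ^ (2 * r)" using C by (simp add: zero_le_power_eq)
  show ?case
  proof (cases "l \<le> 2 ^ J")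
    case True
    then show ?thesis using Suc.IH[OF True, of a] nn[of "a + 2 ^ J"] nn' by simp
  next
    case False
    then obtain l' where l': "l = 2 ^ J + l'" by (metis le_add_diff_inverse nat_le_linear)
    have "(\<Sum>t=a..<a + l. x t) = (\<Sum>t=a..<a + 2 ^ J. x t) + (\<Sum>t=a + 2 ^ J..<a + 2 ^ J + l'. x t)"
      by (simp add: l' sum.atLeastLessThan_concat add.assoc)
    then have "(\<Sum>t=a..<a + l. x t) ^ (2 * r)
        \<le> C * (\<Sum>t=a..<a + 2 ^ J. x t) ^ (2 * r) + 2 * (\<Sum>t=a + 2 ^ J..<a + 2 ^ J + l'. x t) ^ (2 * r)"
      using C(2) by simp
    also have "(\<Sum>t=a + 2 ^ J..<a + 2 ^ J + l'. x t) ^ (2 * r) \<le> chain_bound C (2 * r) x J (a + 2 ^ J)"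
      using Suc.IH Suc.prems l' by simp
    finally show ?thesis using nn[of a] by simp
  qed
qed

text \<open>For \<open>r \<ge> 2\<close> the moments \<open>l ^ r\<close> outgrow the factor \<open>3\<close> lost in each doubling of the length.\<close>

lemma nn_integral_chain_bound_le:
  assumes X[measurable]: "\<And>t. X t \<in> borel_measurable M"
    and C: "0 \<le> C" and c: "0 \<le> c" and r: "2 \<le> r"
    and moment: "\<And>a l. (\<integral>\<^sup>+ \<omega>. ennreal ((\<Sum>t=a..<a + l. X t \<omega>) ^ (2 * r)) \<partial>M) \<le> ennreal (c * real l ^ r)"
  shows "(\<integral>\<^sup>+ \<omega>. ennreal (chain_bound C (2 * r) (\<lambda>t. X t \<omega>) J a) \<partial>M) \<le> ennreal ((1 + C) * c * (2 ^ J) ^ r)"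
proof (induction J arbitrary: a)
  case 0
  have "(\<integral>\<^sup>+ \<omega>. ennreal (X a \<omega> ^ (2 * r)) \<partial>M) \<le> ennreal c" using moment[of a 1] by simp
  also have "\<dots> \<le> ennreal ((1 + C) * c)" using C c by (intro ennreal_leI) (auto simp: algebra_simps)
  finally show ?case by simp
next
  case (Suc J)
  let ?Z = "\<lambda>a \<omega>. chain_bound C (2 * r) (\<lambda>t. X t \<omega>) J a"
  let ?S = "\<lambda>\<omega>. (\<Sum>t=a..<a + 2 ^ J. X t \<omega>) ^ (2 * r)"
  let ?K = "(1 + C) * c * (2 ^ J) ^ r"
  have nn: "0 \<le> ?Z a \<omega>" "0 \<le> ?S \<omega>" for a \<omega>
    using C by (auto intro!: chain_bound_nonneg simp: zero_le_power_eq)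
  have linear: "ennreal x + 2 * ennreal y + ennreal C * ennreal z = ennreal (x + 2 * y + C * z)"
    if "0 \<le> x" "0 \<le> y" "0 \<le> z" for x y z
    using that C by (simp add: ennreal_mult')
  have "(\<integral>\<^sup>+ \<omega>. ennreal (chain_bound C (2 * r) (\<lambda>t. X t \<omega>) (Suc J) a) \<partial>M)
      = (\<integral>\<^sup>+ \<omega>. ennreal (?Z a \<omega>) + 2 * ennreal (?Z (a + 2 ^ J) \<omega>) + ennreal C * ennreal (?S \<omega>) \<partial>M)"
    by (intro nn_integral_cong) (simp add: linear[OF nn(1) nn(1) nn(2)])
  also have "\<dots> = (\<integral>\<^sup>+ \<omega>. ennreal (?Z a \<omega>) \<partial>M) + 2 * (\<integral>\<^sup>+ \<omega>. ennreal (?Z (a + 2 ^ J) \<omega>) \<partial>M)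
      + ennreal C * (\<integral>\<^sup>+ \<omega>. ennreal (?S \<omega>) \<partial>M)"
    by (simp add: nn_integral_add nn_integral_cmult)
  also have "\<dots> \<le> ennreal ?K + 2 * ennreal ?K + ennreal C * ennreal (c * real (2 ^ J) ^ r)"
    by (intro add_mono mult_left_mono Suc.IH moment) auto
  also have "\<dots> = ennreal (?K + 2 * ?K + C * (c * (2 ^ J) ^ r))"
    by (subst linear) (use C c in auto)
  also have "\<dots> \<le> ennreal ((1 + C) * c * (2 ^ Suc J) ^ r)"
  proof (rule ennreal_leI)
    \<comment> \<open>The recursive terms contribute \<open>3 * ?K\<close> and the full left half at
      most another \<open>?K\<close>. The total factor \<open>2 ^ 2\<close> is absorbed by
      \<open>2 ^ r\<close>, which is where \<open>r \<ge> 2\<close> enters.\<close>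
    have "C * (c * (2 ^ J) ^ r) \<le> ?K" using C c by (simp add: algebra_simps)
    moreover have "x + 2 * x + y \<le> 2 ^ 2 * x" if "y \<le> x" for x y :: real using that by simp
    ultimately have "?K + 2 * ?K + C * (c * (2 ^ J) ^ r) \<le> 2 ^ 2 * ?K" by blast
    also have "\<dots> \<le> 2 ^ r * ?K"
      using C c r by (intro mult_right_mono power_increasing) auto
    also have "\<dots> = (1 + C) * c * (2 ^ Suc J) ^ r" by (simp add: power_mult_distrib)
    finally show "?K + 2 * ?K + C * (c * (2 ^ J) ^ r) \<le> (1 + C) * c * (2 ^ Suc J) ^ r" .
  qed
  finally show ?case .
qed

lemma sum_geometric_le:
  fixes y :: real
  assumes "0 \<le> y" "y \<le> 1 / 2"
  shows "(\<Sum>J=j..<j + k. y ^ J) \<le> 2 * y ^ j"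
proof -
  \<comment> \<open>The extra term \<open>2 * y ^ (j + k)\<close> strengthens the claim for the
    induction: it dominates the next summand together with its own successor.\<close>
  have "(\<Sum>J=j..<j + k. y ^ J) + 2 * y ^ (j + k) \<le> 2 * y ^ j"
  proof (induction k)
    case (Suc k)
    have "y * y ^ (j + k) \<le> 1 / 2 * y ^ (j + k)" using assms by (intro mult_right_mono) auto
    then show ?case using Suc by simp
  qed simp
  then show ?thesis using assms zero_le_power[of y "j + k"] by linarith
qed

text \<open>Lengths between \<open>2 ^ J\<close> and \<open>2 ^ (J + 1)\<close> share one chain
  bound. After division by \<open>(2 ^ J) ^ (2 * r)\<close> its expectation is of order
  \<open>c / (2 ^ J) ^ r\<close>, so the sum over the levels from that of \<open>m\<close> onwards
  is a geometric series dominated by its first term. Hence \<open>K\<close> depends on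
  \<open>r\<close> alone and not on the maximal length \<open>N\<close>. The measurable majorant
  \<open>W\<close> stands in for the maximum.\<close>

lemma maximal_average_moment:
  assumes r: "2 \<le> r"
  shows "\<exists>K>0. \<forall>(M :: 'a measure) X c m N.
    (\<forall>t. X t \<in> borel_measurable M) \<longrightarrow> 0 \<le> c \<longrightarrow> 1 \<le> m \<longrightarrow>
    (\<forall>a l. (\<integral>\<^sup>+ \<omega>. ennreal ((\<Sum>t=a..<a + l. X t \<omega>) ^ (2 * r)) \<partial>M) \<le> ennreal (c * real l ^ r)) \<longrightarrow>
    (\<exists>W \<in> borel_measurable M. (\<forall>\<omega>. 0 \<le> W \<omega>) \<and>
      (\<forall>\<omega>. \<forall>l\<in>{m..N}. ((\<Sum>t<l. X t \<omega>) / real l) ^ (2 * r) \<le> W \<omega>) \<and>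
      (\<integral>\<^sup>+ \<omega>. ennreal (W \<omega>) \<partial>M) \<le> ennreal (K * c / real m ^ r))"
proof -
  obtain C where C: "0 \<le> C" "\<And>x y::real. (x + y) ^ (2 * r) \<le> C * x ^ (2 * r) + 2 * y ^ (2 * r)"
    using power_add_le_mult_power[of r] by blast
  \<comment> \<open>The power of two collects \<open>2 ^ r\<close> from passing to level
    \<open>Suc J\<close>, \<open>2 ^ r\<close> from comparing \<open>2 ^ j\<close> with
    \<open>m\<close>, and 2 from the geometric series.\<close>
  define K where "K = (1 + C) * 2 ^ (2 * r + 1)"
  have "\<exists>W \<in> borel_measurable M. (\<forall>\<omega>. 0 \<le> W \<omega>) \<and>
      (\<forall>\<omega>. \<forall>l\<in>{m..N}. ((\<Sum>t<l. X t \<omega>) / real l) ^ (2 * r) \<le> W \<omega>) \<and>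
      (\<integral>\<^sup>+ \<omega>. ennreal (W \<omega>) \<partial>M) \<le> ennreal (K * c / real m ^ r)"
    if X[measurable]: "\<And>t. X t \<in> borel_measurable M" and c: "0 \<le> c" and m: "1 \<le> m"
      and moment: "\<And>a l. (\<integral>\<^sup>+ \<omega>. ennreal ((\<Sum>t=a..<a + l. X t \<omega>) ^ (2 * r)) \<partial>M) \<le> ennreal (c * real l ^ r)"
    for M :: "'a measure" and X :: "nat \<Rightarrow> 'a \<Rightarrow> real" and c and m N
  proof -
    obtain j where j: "2 ^ j \<le> m" "m < 2 ^ (j + 1)" using ex_power_ivl1[of 2 m] m by auto
    define Z where "Z = (\<lambda>J \<omega>. chain_bound C (2 * r) (\<lambda>t. X t \<omega>) (Suc J) 0)"
    define W where "W = (\<lambda>\<omega>. \<Sum>J=j..<j + N. Z J \<omega> / (2 ^ J) ^ (2 * r))"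
    have nn: "0 \<le> Z J \<omega>" for J \<omega> unfolding Z_def using C by (intro chain_bound_nonneg) auto
    have [measurable]: "Z J \<in> borel_measurable M" for J unfolding Z_def by measurable
    have Wm: "W \<in> borel_measurable M" unfolding W_def by measurable
    have W0: "0 \<le> W \<omega>" for \<omega> unfolding W_def using nn by (intro sum_nonneg divide_nonneg_nonneg) auto
    have dom: "((\<Sum>t<l. X t \<omega>) / real l) ^ (2 * r) \<le> W \<omega>" if l: "l \<in> {m..N}" for l \<omega>
    proof -
      obtain J where J: "2 ^ J \<le> l" "l < 2 ^ (J + 1)" using ex_power_ivl1[of 2 l] l m by auto
      have "2 ^ j < (2::nat) ^ Suc J" using J j l by auto
      then have "j \<le> J" using power_strict_increasing_iff[of "2::nat" j "Suc J"]
        by simp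
      \<comment> \<open>The crude bound \<open>J < 2 ^ J\<close> shows that the \<open>N\<close>
        levels summed in \<open>W\<close> reach every length up to \<open>N\<close>.\<close>
      moreover have "J < l" using less_exp J(1) by (rule less_le_trans)
      then have "J < N" using l by simp
      ultimately have Jin: "J \<in> {j..<j + N}" by auto
      have "(\<Sum>t<l. X t \<omega>) ^ (2 * r) \<le> Z J \<omega>"
        using partial_sum_power_le_chain_bound[OF C, of l "Suc J" "\<lambda>t. X t \<omega>" 0] r less_imp_le[OF J(2)]
        by (simp add: atLeast0LessThan Z_def del: chain_bound.simps)
      moreover have "2 ^ J \<le> real l" using of_nat_mono[OF J(1), where 'a = real] by simp
      then have "(2 ^ J) ^ (2 * r) \<le> real l ^ (2 * r)" by (intro power_mono) auto
      ultimately have "(\<Sum>t<l. X t \<omega>) ^ (2 * r) / real l ^ (2 * r) \<le> Z J \<omega> / (2 ^ J) ^ (2 * r)"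
        using nn by (intro frac_le) auto
      also have "\<dots> \<le> W \<omega>" unfolding W_def
        by (rule member_le_sum[OF Jin]) (use nn in \<open>auto intro!: divide_nonneg_nonneg\<close>)
      finally show ?thesis by (simp add: power_divide)
    qed
    have "(\<integral>\<^sup>+ \<omega>. ennreal (W \<omega>) \<partial>M)
        = (\<integral>\<^sup>+ \<omega>. (\<Sum>J=j..<j + N. ennreal (1 / (2 ^ J) ^ (2 * r)) * ennreal (Z J \<omega>)) \<partial>M)"
      unfolding W_def using nn
      by (intro nn_integral_cong, subst sum_ennreal[symmetric])
         (auto simp: ennreal_mult'[symmetric] intro!: divide_nonneg_nonneg)
    also have "\<dots> = (\<Sum>J=j..<j + N. ennreal (1 / (2 ^ J) ^ (2 * r)) * (\<integral>\<^sup>+ \<omega>. ennreal (Z J \<omega>) \<partial>M))"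
      by (simp add: nn_integral_sum nn_integral_cmult)
    also have "\<dots> \<le> (\<Sum>J=j..<j + N. ennreal (1 / (2 ^ J) ^ (2 * r)) * ennreal ((1 + C) * c * (2 ^ Suc J) ^ r))"
      unfolding Z_def
      by (intro sum_mono mult_left_mono nn_integral_chain_bound_le[OF X C(1) c r moment]) auto
    also have "\<dots> = ennreal (\<Sum>J=j..<j + N. 1 / (2 ^ J) ^ (2 * r) * ((1 + C) * c * (2 ^ Suc J) ^ r))"
    proof -
      have "ennreal (1 / (2 ^ J) ^ (2 * r)) * ennreal ((1 + C) * c * (2 ^ Suc J) ^ r)
          = ennreal (1 / (2 ^ J) ^ (2 * r) * ((1 + C) * c * (2 ^ Suc J) ^ r))" for J
        using C c by (intro ennreal_mult[symmetric]) auto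
      then show ?thesis using C c by (simp only:, intro sum_ennreal) auto
    qed
    also have "(\<Sum>J=j..<j + N. 1 / (2 ^ J) ^ (2 * r) * ((1 + C) * c * (2 ^ Suc J) ^ r))
        = (1 + C) * c * 2 ^ r * (\<Sum>J=j..<j + N. (1 / 2 ^ r) ^ J)"
      unfolding sum_distrib_left
    proof (intro sum.cong refl)
      fix J
      have "(2 ^ Suc J :: real) ^ r = 2 ^ r * (2 ^ r) ^ J" "((2::real) ^ J) ^ (2 * r) = (2 ^ r) ^ J * (2 ^ r) ^ J"
        by (simp_all add: power_mult_distrib flip: power_mult power_add)
      then show "1 / (2 ^ J) ^ (2 * r) * ((1 + C) * c * (2 ^ Suc J) ^ r) = (1 + C) * c * 2 ^ r * (1 / 2 ^ r) ^ J"
        by (simp add: power_divide field_simps)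
    qed
    also have "ennreal \<dots> \<le> ennreal ((1 + C) * c * 2 ^ r * (2 * (2 ^ r / real m ^ r)))"
    proof (intro ennreal_leI mult_left_mono)
      have "(2::real) ^ 1 \<le> 2 ^ r" using r by (intro power_increasing) auto
      then have "(\<Sum>J=j..<j + N. (1 / 2 ^ r) ^ J) \<le> 2 * (1 / 2 ^ r :: real) ^ j"
        by (intro sum_geometric_le) (auto simp: field_simps)
      also have "(1 / 2 ^ r :: real) ^ j = (1 / 2 ^ j) ^ r"
        by (simp add: power_divide mult.commute flip: power_mult)
      also have "\<dots> \<le> (2 / real m) ^ r"
      proof (rule power_mono)
        have "real m \<le> 2 * 2 ^ j" using j(2)
          by (metis less_imp_le numeral_power_le_of_nat_cancel_iff of_nat_le_numeral_power_cancel_iff power_Suc Suc_eq_plus1)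
        then show "1 / 2 ^ j \<le> 2 / real m" using m by (simp add: field_simps)
      qed simp
      finally show "(\<Sum>J=j..<j + N. (1 / 2 ^ r) ^ J) \<le> 2 * (2 ^ r / real m ^ r)"
        by (simp add: power_divide)
    qed (use C c in auto)
    also have "(1 + C) * c * 2 ^ r * (2 * (2 ^ r / real m ^ r)) = K * c / real m ^ r"
    proof -
      have "(2::real) ^ (2 * r + 1) = 2 ^ r * 2 ^ r * 2" by (subst mult_2) (simp add: power_add)
      then show ?thesis unfolding K_def by (simp only: mult_ac times_divide_eq_left times_divide_eq_right)
    qed
    finally show ?thesis using Wm W0 dom by blast
  qed
  moreover have "K > 0" using C by (simp add: K_def)
  ultimately show ?thesis by blast
qed

subsection \<open>Gaussian noise\<close>

lemma sets_gaussian_noise: "sets (gaussian_noise n \<sigma>) = sets (\<Pi>\<^sub>M i\<in>{1..n}. borel)"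
  unfolding gaussian_noise_def by (rule sets_PiM_cong) auto

lemma prob_space_gaussian_noise: "0 < \<sigma> \<Longrightarrow> prob_space (gaussian_noise n \<sigma>)"
  unfolding gaussian_noise_def by (intro prob_space_PiM prob_space_normal_density)

lemma measurable_gaussian_noise_component:
  "i \<in> {1..n} \<Longrightarrow> (\<lambda>\<epsilon>. \<epsilon> i) \<in> borel_measurable (gaussian_noise n \<sigma>)"
  by (simp cong: measurable_cong_sets add: sets_gaussian_noise)

text \<open>A sum of independent centred normals is normal with standard deviation
  \<open>sqrt (card I) * \<sigma>\<close>; the factorial quotient is the moment of order
  \<open>2 * r\<close> of the standard normal law.\<close>

lemma gaussian_noise_partial_sum_moment:
  assumes \<sigma>: "0 < \<sigma>" and r: "1 \<le> r" and I: "I \<subseteq> {1..n}"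
  shows "(\<integral>\<^sup>+ \<epsilon>. ennreal ((\<Sum>i\<in>I. \<epsilon> i) ^ (2 * r)) \<partial>gaussian_noise n \<sigma>)
    = ennreal (fact (2 * r) / (2 ^ r * fact r) * \<sigma> ^ (2 * r) * real (card I) ^ r)"
\<comment> \<open>The empty sum is degenerate and has no normal density; there both sides
  vanish.\<close>
proof (cases "I = {}")
  case True
  then show ?thesis using r by (simp add: power_0_left)
next
  case False
  let ?N = "density lborel (normal_density 0 \<sigma>)" and ?G = "gaussian_noise n \<sigma>"
  have N: "prob_space ?N" by (rule prob_space_normal_density[OF \<sigma>])
  interpret prob_space ?G by (rule prob_space_gaussian_noise[OF \<sigma>])
  have comp: "distr ?G borel (\<lambda>\<omega>. \<omega> i) = ?N" if "i \<in> {1..n}" for i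
  proof -
    have "distr ?G borel (\<lambda>\<omega>. \<omega> i) = distr ?G ?N (\<lambda>\<omega>. \<omega> i)" by (rule distr_cong) auto
    also have "\<dots> = ?N" unfolding gaussian_noise_def using N that by (rule distr_PiM_component)
    finally show ?thesis .
  qed
  note rv = measurable_gaussian_noise_component[of _ n \<sigma>]
  \<comment> \<open>Independence of the coordinates is read off from their joint law. Points of the
    sample space are extensional, so restricting them to \<open>{1..n}\<close> changes nothing, and
    the joint law is the product measure itself.\<close>
  have "distr ?G (\<Pi>\<^sub>M i\<in>{1..n}. borel) (\<lambda>x. \<lambda>i\<in>{1..n}. x i) = distr ?G ?G (\<lambda>x. x)"
  proof (rule distr_cong)
    fix x assume "x \<in> space ?G"
    then have "x \<in> extensional {1..n}" by (auto simp: gaussian_noise_def space_PiM PiE_def)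
    then show "(\<lambda>i\<in>{1..n}. x i) = x" by (rule extensional_restrict)
  qed (use sets_gaussian_noise in auto)
  also have "\<dots> = (\<Pi>\<^sub>M i\<in>{1..n}. distr ?G borel (\<lambda>\<omega>. \<omega> i))"
    unfolding distr_id by (subst gaussian_noise_def, rule PiM_cong) (use comp in auto)
  finally have "indep_vars (\<lambda>_. borel) (\<lambda>i \<omega>. \<omega> i) {1..n}"
    using I False rv by (subst indep_vars_iff_distr_eq_PiM') auto
  then have "indep_vars (\<lambda>_. borel) (\<lambda>i \<omega>. \<omega> i) I" by (rule indep_vars_subset) (rule I)
  moreover have "distributed ?G lborel (\<lambda>\<omega>. \<omega> i) (normal_density 0 \<sigma>)" if "i \<in> I" for i
    unfolding distributed_def
  proof (intro conjI)
    have "distr ?G lborel (\<lambda>\<omega>. \<omega> i) = distr ?G borel (\<lambda>\<omega>. \<omega> i)" by (rule distr_cong) auto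
    then show "distr ?G lborel (\<lambda>\<omega>. \<omega> i) = ?N" using comp[of i] that I by auto
  qed (use rv that I in auto)
  ultimately have "distributed ?G lborel (\<lambda>\<omega>. \<Sum>i\<in>I. \<omega> i) (normal_density (\<Sum>i\<in>I. 0) (sqrt (\<Sum>i\<in>I. \<sigma>\<^sup>2)))"
    using \<sigma> False finite_subset[OF I] by (intro sum_indep_normal) auto
  moreover define s where "s = sqrt (real (card I)) * \<sigma>"
  ultimately have dist: "distributed ?G lborel (\<lambda>\<omega>. \<Sum>i\<in>I. \<omega> i) (normal_density 0 s)"
    using \<sigma> by (simp add: real_sqrt_mult)
  have s: "s > 0" using \<sigma> False finite_subset[OF I] by (auto simp: s_def card_gt_0_iff)
  have "(\<integral>\<^sup>+ \<epsilon>. ennreal ((\<Sum>i\<in>I. \<epsilon> i) ^ (2 * r)) \<partial>?G)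
      = (\<integral>\<^sup>+ x. ennreal (normal_density 0 s x) * ennreal (x ^ (2 * r)) \<partial>lborel)"
    by (rule distributed_nn_integral[OF dist, symmetric]) auto
  also have "\<dots> = (\<integral>\<^sup>+ x. ennreal (normal_density 0 s x * (x - 0) ^ (2 * r)) \<partial>lborel)"
    by (simp add: ennreal_mult power_mult)
  also have "\<dots> = ennreal (fact (2 * r) / ((2 / s\<^sup>2) ^ r * fact r))"
    using normal_moment_even[OF s, of 0 r]
    by (subst nn_integral_eq_integral) (auto simp: has_bochner_integral_iff zero_le_power_eq)
  also have "fact (2 * r) / ((2 / s\<^sup>2) ^ r * fact r)
      = fact (2 * r) / (2 ^ r * fact r) * \<sigma> ^ (2 * r) * real (card I) ^ r"
    by (simp add: s_def power_mult power_mult_distrib power_divide)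
  finally show ?thesis .
qed

section \<open>From even moments to moments of real order\<close>

text \<open>Below the threshold \<open>s\<close> the first term suffices. Above it,
  \<open>x powr (p - real k)\<close> is at most its value at \<open>s\<close>, because the exponent
  is nonpositive.\<close>

lemma powr_le_powr_add:
  fixes x s p :: real
  assumes "0 \<le> x" "0 < s" "0 \<le> p" "p \<le> real k"
  shows "x powr p \<le> s powr p + s powr (p - real k) * x ^ k"
proof (cases "x \<le> s")
  case True
  then have "x powr p \<le> s powr p" using assms by (intro powr_mono2) auto
  moreover have "0 \<le> s powr (p - real k) * x ^ k" using assms by auto
  ultimately show ?thesis by linarith
next
  case False
  then have "x powr p = x powr (p - real k) * x ^ k"
    using assms by (simp add: powr_diff powr_realpow)
  also have "\<dots> \<le> s powr (p - real k) * x ^ k"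
    using False assms by (intro mult_right_mono powr_mono2') auto
  finally show ?thesis using powr_ge_zero[of s p] by linarith
qed

text \<open>The maximal inequality for an even order above \<open>p\<close> is brought down to order
  \<open>p\<close> at the natural scale of an average of \<open>m\<close> terms. The map
  \<open>g\<close> fixes the order of summation, so that windows growing to the left and to the
  right are both covered.\<close>

lemma gaussian_maximal_average:
  fixes p :: real
  assumes p: "0 \<le> p"
  shows "\<exists>D>0. \<forall>n \<sigma> g L m. 0 < \<sigma> \<longrightarrow> inj_on g {..<L} \<longrightarrow> g ` {..<L} \<subseteq> {1..n} \<longrightarrow> 1 \<le> m \<longrightarrow>
    (\<exists>V \<in> borel_measurable (gaussian_noise n \<sigma>). (\<forall>\<epsilon>. 0 \<le> V \<epsilon>) \<and>
      (\<forall>\<epsilon>. \<forall>l\<in>{m..L}. \<bar>(\<Sum>t<l. \<epsilon> (g t)) / real l\<bar> powr p \<le> V \<epsilon>) \<and>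
      (\<integral>\<^sup>+ \<epsilon>. ennreal (V \<epsilon>) \<partial>gaussian_noise n \<sigma>) \<le> ennreal (D * \<sigma> powr p * real m powr (- p / 2)))"
proof -
  \<comment> \<open>Large enough for \<open>p \<le> 2 * r\<close>, and at least 2 as the maximal
    inequality demands.\<close>
  define r where "r = nat \<lceil>p\<rceil> + 2"
  have r: "2 \<le> r" and pr: "p \<le> real (2 * r)" using p by (auto simp: r_def) linarith
  define f :: real where "f = fact (2 * r) / (2 ^ r * fact r)"
  have f: "f > 0" by (simp add: f_def)
  obtain K where K: "K > 0" and max: "\<And>(M :: (nat \<Rightarrow> real) measure) X c m N.
      (\<And>t. X t \<in> borel_measurable M) \<Longrightarrow> 0 \<le> c \<Longrightarrow> 1 \<le> m \<Longrightarrow>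
      (\<And>a l. (\<integral>\<^sup>+ \<omega>. ennreal ((\<Sum>t=a..<a + l. X t \<omega>) ^ (2 * r)) \<partial>M) \<le> ennreal (c * real l ^ r)) \<Longrightarrow>
      (\<exists>W \<in> borel_measurable M. (\<forall>\<omega>. 0 \<le> W \<omega>) \<and>
        (\<forall>\<omega>. \<forall>l\<in>{m..N}. ((\<Sum>t<l. X t \<omega>) / real l) ^ (2 * r) \<le> W \<omega>) \<and>
        (\<integral>\<^sup>+ \<omega>. ennreal (W \<omega>) \<partial>M) \<le> ennreal (K * c / real m ^ r))"
    using maximal_average_moment[OF r, where 'a = "nat \<Rightarrow> real"] by metis
  show ?thesis
  \<comment> \<open>The two summands come from the two terms of \<open>powr_le_powr_add\<close>: the
    threshold itself and the moment of order \<open>2 * r\<close>.\<close>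
  proof (intro exI[of _ "1 + K * f"] conjI allI impI)
    show "0 < 1 + K * f" using K f by (simp add: add_pos_pos)
    fix n L m :: nat and \<sigma> :: real and g :: "nat \<Rightarrow> nat"
    assume \<sigma>: "0 < \<sigma>" and g: "inj_on g {..<L}" "g ` {..<L} \<subseteq> {1..n}" and m: "1 \<le> m"
    let ?G = "gaussian_noise n \<sigma>"
    interpret prob_space ?G by (rule prob_space_gaussian_noise[OF \<sigma>])
    \<comment> \<open>Padding by zero beyond \<open>L\<close> gives a sequence indexed by all
      naturals. Any window of length \<open>l\<close> then involves at most \<open>l\<close>
      distinct noise coordinates, so the moment bound holds for every window.\<close>
    define X where "X = (\<lambda>t (\<epsilon> :: nat \<Rightarrow> real). if t < L then \<epsilon> (g t) else 0)"
    have Xm: "X t \<in> borel_measurable ?G" for t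
      using measurable_gaussian_noise_component[of "g t" n \<sigma>] g(2)
      by (cases "t < L") (auto simp: X_def image_subset_iff)
    have "(\<integral>\<^sup>+ \<epsilon>. ennreal ((\<Sum>t=a..<a + l. X t \<epsilon>) ^ (2 * r)) \<partial>?G)
        \<le> ennreal (f * \<sigma> ^ (2 * r) * real l ^ r)" for a l
    proof -
      define T where "T = {a..<a + l} \<inter> {..<L}"
      have T: "inj_on g T" "g ` T \<subseteq> {1..n}" using g by (auto simp: T_def intro: inj_on_subset)
      have "(\<Sum>t=a..<a + l. X t \<epsilon>) = (\<Sum>i\<in>g ` T. \<epsilon> i)" for \<epsilon>
        by (subst sum.reindex[OF T(1)]) (simp add: T_def X_def sum.inter_restrict)
      then have "(\<integral>\<^sup>+ \<epsilon>. ennreal ((\<Sum>t=a..<a + l. X t \<epsilon>) ^ (2 * r)) \<partial>?G)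
          = ennreal (f * \<sigma> ^ (2 * r) * real (card (g ` T)) ^ r)"
        using gaussian_noise_partial_sum_moment[OF \<sigma> _ T(2), of r] r by (simp add: f_def)
      also have "\<dots> \<le> ennreal (f * \<sigma> ^ (2 * r) * real l ^ r)"
      proof (intro ennreal_leI mult_left_mono power_mono)
        have "card T \<le> card {a..<a + l}" unfolding T_def by (intro card_mono) auto
        then show "real (card (g ` T)) \<le> real l" by (simp add: card_image[OF T(1)])
      qed (use f \<sigma> in auto)
      finally show ?thesis .
    qed
    from max[OF Xm _ m this, of L] \<sigma> f
    obtain W where W: "W \<in> borel_measurable ?G" "\<And>\<epsilon>. 0 \<le> W \<epsilon>"
      and dom: "\<And>\<epsilon> l. l \<in> {m..L} \<Longrightarrow> ((\<Sum>t<l. X t \<epsilon>) / real l) ^ (2 * r) \<le> W \<epsilon>"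
      and int: "(\<integral>\<^sup>+ \<epsilon>. ennreal (W \<epsilon>) \<partial>?G) \<le> ennreal (K * (f * \<sigma> ^ (2 * r)) / real m ^ r)"
      by auto
    \<comment> \<open>The standard deviation of an average of \<open>m\<close> noise terms; with it
      both terms of \<open>V\<close> have expectation of order \<open>s powr p\<close>.\<close>
    define s where "s = \<sigma> * real m powr (- 1 / 2)"
    have s: "s > 0" using \<sigma> m by (simp add: s_def)
    have sp: "s powr p = \<sigma> powr p * real m powr (- p / 2)"
      using \<sigma> by (simp add: s_def powr_mult powr_powr)
    define V where "V = (\<lambda>\<epsilon>. s powr p + s powr (p - real (2 * r)) * W \<epsilon>)"
    have "\<bar>(\<Sum>t<l. \<epsilon> (g t)) / real l\<bar> powr p \<le> V \<epsilon>" if "l \<in> {m..L}" for \<epsilon> l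
    proof -
      have X: "(\<Sum>t<l. X t \<epsilon>) = (\<Sum>t<l. \<epsilon> (g t))" using that by (intro sum.cong) (auto simp: X_def)
      have "\<bar>(\<Sum>t<l. \<epsilon> (g t)) / real l\<bar> powr p
          \<le> s powr p + s powr (p - real (2 * r)) * \<bar>(\<Sum>t<l. \<epsilon> (g t)) / real l\<bar> ^ (2 * r)"
        by (rule powr_le_powr_add) (use s p pr in auto)
      also have "\<dots> \<le> V \<epsilon>"
        unfolding V_def using dom[OF that, of \<epsilon>] X
        by (intro add_left_mono mult_left_mono) (auto simp: power_even_abs simp del: abs_divide)
      finally show ?thesis .
    qed
    moreover have "(\<integral>\<^sup>+ \<epsilon>. ennreal (V \<epsilon>) \<partial>?G) \<le> ennreal ((1 + K * f) * \<sigma> powr p * real m powr (- p / 2))"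
    proof -
      have "(\<integral>\<^sup>+ \<epsilon>. ennreal (V \<epsilon>) \<partial>?G)
          = (\<integral>\<^sup>+ \<epsilon>. ennreal (s powr p) + ennreal (s powr (p - real (2 * r))) * ennreal (W \<epsilon>) \<partial>?G)"
        using W by (simp add: V_def ennreal_mult')
      also have "\<dots> = ennreal (s powr p) + ennreal (s powr (p - real (2 * r))) * (\<integral>\<^sup>+ \<epsilon>. ennreal (W \<epsilon>) \<partial>?G)"
        using W by (simp add: nn_integral_add nn_integral_cmult emeasure_space_1)
      also have "\<dots> \<le> ennreal (s powr p)
          + ennreal (s powr (p - real (2 * r))) * ennreal (K * (f * \<sigma> ^ (2 * r)) / real m ^ r)"
        by (intro add_left_mono mult_left_mono int) auto
      also have "\<dots> = ennreal (s powr p + s powr (p - real (2 * r)) * (K * (f * \<sigma> ^ (2 * r)) / real m ^ r))"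
      proof -
        have "ennreal (s powr (p - real (2 * r))) * ennreal (K * (f * \<sigma> ^ (2 * r)) / real m ^ r)
            = ennreal (s powr (p - real (2 * r)) * (K * (f * \<sigma> ^ (2 * r)) / real m ^ r))"
          using K f \<sigma> by (intro ennreal_mult[symmetric]) auto
        then show ?thesis using K f \<sigma> by (simp only:) (intro ennreal_plus[symmetric], auto)
      qed
      also have "K * (f * \<sigma> ^ (2 * r)) / real m ^ r = K * f * s powr real (2 * r)"
      proof -
        have "s powr real (2 * r) = \<sigma> powr real (2 * r) * real m powr (- real r)"
          using \<sigma> by (simp add: s_def powr_mult powr_powr)
        also have "\<dots> = \<sigma> ^ (2 * r) / real m ^ r"
          using \<sigma> m by (simp only: powr_realpow powr_minus_divide) simp
        finally show ?thesis by simp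
      qed
      also have "s powr p + s powr (p - real (2 * r)) * (K * f * s powr real (2 * r)) = (1 + K * f) * s powr p"
        using s by (simp add: powr_diff algebra_simps)
      finally show ?thesis by (simp add: sp mult.assoc)
    qed
    moreover have "V \<in> borel_measurable ?G" "\<forall>\<epsilon>. 0 \<le> V \<epsilon>" using W by (auto simp: V_def)
    ultimately show "\<exists>V \<in> borel_measurable ?G. (\<forall>\<epsilon>. 0 \<le> V \<epsilon>) \<and>
      (\<forall>\<epsilon>. \<forall>l\<in>{m..L}. \<bar>(\<Sum>t<l. \<epsilon> (g t)) / real l\<bar> powr p \<le> V \<epsilon>) \<and>
      (\<integral>\<^sup>+ \<epsilon>. ennreal (V \<epsilon>) \<partial>?G) \<le> ennreal ((1 + K * f) * \<sigma> powr p * real m powr (- p / 2))"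
      by blast
  qed
qed

section \<open>Risk of a single coordinate\<close>

text \<open>The two one-sided averages squeeze the error at \<open>i\<close> between noise averages
  anchored at the ends \<open>a\<close> and \<open>b\<close> of a stretch where
  \<open>\<theta>\<close> is constant. Their lengths are at least the distances from
  \<open>i\<close> to these ends, counted inclusively.\<close>

lemma isotonic_lse_coordinate_risk:
  fixes p :: real
  assumes p: "0 \<le> p"
  obtains D where "D > 0" and "\<And>n \<sigma> \<theta> a i b. 0 < \<sigma> \<Longrightarrow> \<theta> \<in> isotone_cone n \<Longrightarrow>
    1 \<le> a \<Longrightarrow> a \<le> i \<Longrightarrow> i \<le> b \<Longrightarrow> b \<le> n \<Longrightarrow> \<theta> a = \<theta> b \<Longrightarrow>
    (\<integral>\<^sup>+ \<epsilon>. ennreal (\<bar>isotonic_lse n (\<lambda>j\<in>{1..n}. \<theta> j + \<epsilon> j) i - \<theta> i\<bar> powr p) \<partial>gaussian_noise n \<sigma>)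
      \<le> ennreal (D * \<sigma> powr p * (real (b + 1 - i) powr (- p / 2) + real (i + 1 - a) powr (- p / 2)))"
proof -
  obtain D where D: "D > 0" and max: "\<And>n \<sigma> g L m. 0 < \<sigma> \<Longrightarrow> inj_on g {..<L} \<Longrightarrow>
    g ` {..<L} \<subseteq> {1..n} \<Longrightarrow> 1 \<le> m \<Longrightarrow>
    (\<exists>V \<in> borel_measurable (gaussian_noise n \<sigma>). (\<forall>\<epsilon>. 0 \<le> V \<epsilon>) \<and>
      (\<forall>\<epsilon>. \<forall>l\<in>{m..L}. \<bar>(\<Sum>t<l. \<epsilon> (g t)) / real l\<bar> powr p \<le> V \<epsilon>) \<and>
      (\<integral>\<^sup>+ \<epsilon>. ennreal (V \<epsilon>) \<partial>gaussian_noise n \<sigma>) \<le> ennreal (D * \<sigma> powr p * real m powr (- p / 2)))"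
    using gaussian_maximal_average[OF p] by metis
  show thesis
  proof (rule that)
    fix n a i b :: nat and \<sigma> :: real and \<theta>
    assume \<sigma>: "0 < \<sigma>" and \<theta>: "\<theta> \<in> isotone_cone n"
      and i: "1 \<le> a" "a \<le> i" "i \<le> b" "b \<le> n" and eq: "\<theta> a = \<theta> b"
    let ?G = "gaussian_noise n \<sigma>"
    have mono: "\<theta> j \<le> \<theta> k" if "1 \<le> j" "j \<le> k" "k \<le> n" for j k
      using isotone_coneD[OF \<theta>, of j k] that by auto
    have ends: "\<theta> a = \<theta> i" "\<theta> b = \<theta> i" using mono[of a i] mono[of i b] eq i by auto
    \<comment> \<open>The windows need not stay inside \<open>{a..b}\<close>: those ending at
      \<open>b\<close> may reach back to index 1, those starting at \<open>a\<close> may run up to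
      \<open>n\<close>.\<close>
    have left: "inj_on (\<lambda>t. b - t) {..<b}" "(\<lambda>t. b - t) ` {..<b} \<subseteq> {1..n}" "1 \<le> b + 1 - i"
      and right: "inj_on (\<lambda>t. a + t) {..<n + 1 - a}" "(\<lambda>t. a + t) ` {..<n + 1 - a} \<subseteq> {1..n}" "1 \<le> i + 1 - a"
      using i by (auto simp: inj_on_def)
    obtain V1 where V1: "V1 \<in> borel_measurable ?G" "\<And>\<epsilon>. 0 \<le> V1 \<epsilon>"
      and dom1: "\<And>\<epsilon> l. l \<in> {b + 1 - i..b} \<Longrightarrow> \<bar>(\<Sum>t<l. \<epsilon> (b - t)) / real l\<bar> powr p \<le> V1 \<epsilon>"
      and int1: "(\<integral>\<^sup>+ \<epsilon>. ennreal (V1 \<epsilon>) \<partial>?G) \<le> ennreal (D * \<sigma> powr p * real (b + 1 - i) powr (- p / 2))"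
      using max[OF \<sigma> left] by blast
    obtain V2 where V2: "V2 \<in> borel_measurable ?G" "\<And>\<epsilon>. 0 \<le> V2 \<epsilon>"
      and dom2: "\<And>\<epsilon> l. l \<in> {i + 1 - a..n + 1 - a} \<Longrightarrow> \<bar>(\<Sum>t<l. \<epsilon> (a + t)) / real l\<bar> powr p \<le> V2 \<epsilon>"
      and int2: "(\<integral>\<^sup>+ \<epsilon>. ennreal (V2 \<epsilon>) \<partial>?G) \<le> ennreal (D * \<sigma> powr p * real (i + 1 - a) powr (- p / 2))"
      using max[OF \<sigma> right] by blast
    have dom: "\<bar>isotonic_lse n (\<lambda>j\<in>{1..n}. \<theta> j + \<epsilon> j) i - \<theta> i\<bar> powr p \<le> V1 \<epsilon> + V2 \<epsilon>" for \<epsilon>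
    proof -
      let ?Y = "\<lambda>j\<in>{1..n}. \<theta> j + \<epsilon> j"
      let ?w = "isotonic_lse n ?Y i"
      obtain u where u: "u \<in> {1..i}" "real (b + 1 - u) * ?w \<le> (\<Sum>j=u..b. ?Y j)"
        using isotonic_lse_le_average[of i b n ?Y] i by auto
      obtain v where v: "v \<in> {i..n}" "(\<Sum>j=a..v. ?Y j) \<le> real (v + 1 - a) * ?w"
        using isotonic_lse_ge_average[of a i n ?Y] i by auto
      let ?s1 = "(\<Sum>t<b + 1 - u. \<epsilon> (b - t)) / real (b + 1 - u)"
      let ?s2 = "(\<Sum>t<v + 1 - a. \<epsilon> (a + t)) / real (v + 1 - a)"
      have "(\<Sum>j=u..b. ?Y j) = (\<Sum>j=u..b. \<theta> j) + (\<Sum>j=u..b. \<epsilon> j)"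
        using u i by (simp add: sum.distrib)
      \<comment> \<open>This remains true when \<open>u\<close> lies to the left of
        \<open>a\<close>, since \<open>\<theta>\<close> is only smaller there.\<close>
      also have "(\<Sum>j=u..b. \<theta> j) \<le> (\<Sum>j=u..b. \<theta> i)"
        using u i ends(2) mono[of _ b] by (intro sum_mono) auto
      also have "(\<Sum>j=u..b. \<epsilon> j) = (\<Sum>t<b + 1 - u. \<epsilon> (b - t))"
        by (rule sum.reindex_bij_witness[of _ "\<lambda>t. b - t" "\<lambda>j. b - j"]) auto
      finally have "real (b + 1 - u) * (?w - \<theta> i) \<le> (\<Sum>t<b + 1 - u. \<epsilon> (b - t))"
        using u i by (simp add: algebra_simps)
      then have up: "?w - \<theta> i \<le> ?s1" using u i by (simp add: field_simps)
      have "(\<Sum>j=a..v. \<theta> i) \<le> (\<Sum>j=a..v. \<theta> j)"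
        using v i ends(1) mono[of a] by (intro sum_mono) auto
      moreover have "(\<Sum>j=a..v. ?Y j) = (\<Sum>j=a..v. \<theta> j) + (\<Sum>j=a..v. \<epsilon> j)"
        using v i by (simp add: sum.distrib)
      moreover have "(\<Sum>j=a..v. \<epsilon> j) = (\<Sum>t<v + 1 - a. \<epsilon> (a + t))"
        by (rule sum.reindex_bij_witness[of _ "\<lambda>t. a + t" "\<lambda>j. j - a"]) auto
      ultimately have "(\<Sum>t<v + 1 - a. \<epsilon> (a + t)) \<le> real (v + 1 - a) * (?w - \<theta> i)"
        using v i by (simp add: algebra_simps)
      then have low: "?s2 \<le> ?w - \<theta> i" using v i by (simp add: field_simps)
      have "b + 1 - u \<in> {b + 1 - i..b}" "v + 1 - a \<in> {i + 1 - a..n + 1 - a}" using u v i by auto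
      from dom1[OF this(1)] dom2[OF this(2)]
      have "\<bar>?s1\<bar> powr p \<le> V1 \<epsilon>" "\<bar>?s2\<bar> powr p \<le> V2 \<epsilon>" .
      \<comment> \<open>A number between \<open>t\<close> and \<open>s\<close> is no larger in
        absolute value than one of them, so no discussion of the sign of the error is
        required.\<close>
      moreover have "\<bar>x\<bar> \<le> \<bar>s\<bar> \<or> \<bar>x\<bar> \<le> \<bar>t\<bar>" if "x \<le> s" "t \<le> x" for x s t :: real
        using that by linarith
      from this[OF up low] have "\<bar>?w - \<theta> i\<bar> powr p \<le> \<bar>?s1\<bar> powr p \<or> \<bar>?w - \<theta> i\<bar> powr p \<le> \<bar>?s2\<bar> powr p"
        using powr_mono2[OF p abs_ge_zero] by blast
      ultimately show ?thesis using V1(2)[of \<epsilon>] V2(2)[of \<epsilon>] by linarith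
    qed
    have "(\<integral>\<^sup>+ \<epsilon>. ennreal (\<bar>isotonic_lse n (\<lambda>j\<in>{1..n}. \<theta> j + \<epsilon> j) i - \<theta> i\<bar> powr p) \<partial>?G)
        \<le> (\<integral>\<^sup>+ \<epsilon>. ennreal (V1 \<epsilon>) + ennreal (V2 \<epsilon>) \<partial>?G)"
      using dom V1(2) V2(2) by (intro nn_integral_mono) (simp flip: ennreal_plus)
    also have "\<dots> = (\<integral>\<^sup>+ \<epsilon>. ennreal (V1 \<epsilon>) \<partial>?G) + (\<integral>\<^sup>+ \<epsilon>. ennreal (V2 \<epsilon>) \<partial>?G)"
      using V1(1) V2(1) by (intro nn_integral_add) auto
    also have "\<dots> \<le> ennreal (D * \<sigma> powr p * real (b + 1 - i) powr (- p / 2))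
        + ennreal (D * \<sigma> powr p * real (i + 1 - a) powr (- p / 2))"
      by (intro add_mono int1 int2)
    also have "\<dots> = ennreal (D * \<sigma> powr p * (real (b + 1 - i) powr (- p / 2) + real (i + 1 - a) powr (- p / 2)))"
      using D by (simp add: distrib_left flip: ennreal_plus)
    finally show "(\<integral>\<^sup>+ \<epsilon>. ennreal (\<bar>isotonic_lse n (\<lambda>j\<in>{1..n}. \<theta> j + \<epsilon> j) i - \<theta> i\<bar> powr p) \<partial>?G)
      \<le> ennreal (D * \<sigma> powr p * (real (b + 1 - i) powr (- p / 2) + real (i + 1 - a) powr (- p / 2)))" .
  qed (rule D)
qed

subsection \<open>Summation over blocks\<close>

text \<open>Discrete comparison with an integral: by concavity each increment of
  \<open>N powr \<alpha>\<close> is at least the matching summand, and the increments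
  telescope.\<close>

lemma sum_powr_le_powr:
  fixes \<alpha> :: real
  assumes \<alpha>: "0 < \<alpha>" "\<alpha> \<le> 1"
  shows "\<alpha> * (\<Sum>m=1..N. real m powr (\<alpha> - 1)) \<le> real N powr \<alpha>"
proof (induction N)
  case (Suc N)
  have "\<alpha> * real (Suc N) powr (\<alpha> - 1) \<le> real (Suc N) powr \<alpha> - real N powr \<alpha>"
  proof (cases "N = 0")
    case False
    \<comment> \<open>Weighted arithmetic-geometric mean inequality for \<open>N\<close> and
      \<open>Suc N\<close>; division by \<open>Suc N powr (1 - \<alpha>)\<close> turns it into the
      bound on the increment.\<close>
    have "real N powr \<alpha> * real (Suc N) powr (1 - \<alpha>) \<le> \<alpha> * real N + (1 - \<alpha>) * real (Suc N)"
      using \<alpha> False by (intro Youngs_inequality_0) auto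
    also have "\<dots> = real (Suc N) - \<alpha>" by (simp add: algebra_simps)
    finally have "real N powr \<alpha> * real (Suc N) powr (1 - \<alpha>) * real (Suc N) powr (\<alpha> - 1)
        \<le> (real (Suc N) - \<alpha>) * real (Suc N) powr (\<alpha> - 1)"
      by (rule mult_right_mono) simp
    also have "real N powr \<alpha> * real (Suc N) powr (1 - \<alpha>) * real (Suc N) powr (\<alpha> - 1) = real N powr \<alpha>"
      by (simp add: mult.assoc flip: powr_add)
    also have "(real (Suc N) - \<alpha>) * real (Suc N) powr (\<alpha> - 1)
        = real (Suc N) powr \<alpha> - \<alpha> * real (Suc N) powr (\<alpha> - 1)"
      by (simp add: left_diff_distrib powr_mult_base del: of_nat_Suc)
    finally show ?thesis by linarith
  qed (use \<alpha> in auto)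
  then show ?case using Suc by (simp add: distrib_left)
qed simp

text \<open>For \<open>p < 2\<close> the sum grows like \<open>N powr (1 - p / 2)\<close>, for
  \<open>p > 2\<close> the series converges. At \<open>p = 2\<close> the harmonic sum would bring in
  a logarithm.\<close>

lemma sum_neg_powr_half_le:
  fixes p :: real
  assumes "0 < p" "p \<noteq> 2"
  shows "\<exists>A>0. \<forall>N. (\<Sum>m=1..N. real m powr (- p / 2)) \<le> A * real N powr (max (2 - p) 0 / 2)"
proof (cases "p < 2")
  case True
  define \<alpha> where "\<alpha> = 1 - p / 2"
  have \<alpha>: "0 < \<alpha>" "\<alpha> \<le> 1" "- p / 2 = \<alpha> - 1" "max (2 - p) 0 / 2 = \<alpha>"
    using True assms by (auto simp: \<alpha>_def max_def field_simps)
  show ?thesis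
    unfolding \<alpha>(3,4) using \<alpha>(1) sum_powr_le_powr[OF \<alpha>(1,2)]
    by (intro exI[of _ "1 / \<alpha>"]) (auto simp: field_simps)
next
  case False
  then have p: "p > 2" using assms by simp
  have summable: "summable (\<lambda>m. real m powr (- p / 2))" using p by (subst summable_real_powr_iff) auto
  \<comment> \<open>The added 1 makes positivity immediate from nonnegativity of the series.\<close>
  define A where "A = (\<Sum>m. real m powr (- p / 2)) + 1"
  have "A > 0" unfolding A_def by (intro add_nonneg_pos suminf_nonneg summable) auto
  moreover have "(\<Sum>m=1..N. real m powr (- p / 2)) \<le> A * real N powr (max (2 - p) 0 / 2)" for N
  \<comment> \<open>The exponent on the right is 0 here, and \<open>0 powr 0\<close> is 0, whereas
    the power is 1 for positive \<open>N\<close>.\<close>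
  proof (cases "N = 0")
    case False
    have "(\<Sum>m=1..N. real m powr (- p / 2)) \<le> (\<Sum>m. real m powr (- p / 2))"
      by (rule sum_le_suminf[OF summable]) auto
    then show ?thesis using False p by (simp add: A_def max_def)
  qed simp
  ultimately show ?thesis by blast
qed

section \<open>Constant blocks as level sets\<close>

lemma level_set_interval:
  assumes "\<theta> \<in> isotone_cone n" "i \<in> {1..n}"
  obtains a b where "1 \<le> a" "a \<le> i" "i \<le> b" "b \<le> n" "{j\<in>{1..n}. \<theta> j = \<theta> i} = {a..b}"
proof
  let ?L = "{j\<in>{1..n}. \<theta> j = \<theta> i}"
  have L: "finite ?L" "i \<in> ?L" using assms by auto
  have M: "Min ?L \<in> ?L" "Max ?L \<in> ?L" using L Min_in[of ?L] Max_in[of ?L] by blast+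
  show "1 \<le> Min ?L" "Max ?L \<le> n" using M by auto
  show "Min ?L \<le> i" "i \<le> Max ?L" using L by auto
  show "?L = {Min ?L..Max ?L}"
  proof
    show "?L \<subseteq> {Min ?L..Max ?L}" using L(1) by auto
    show "{Min ?L..Max ?L} \<subseteq> ?L"
    proof
      fix j assume j: "j \<in> {Min ?L..Max ?L}"
      then have "j \<in> {1..n}" using M by auto
      moreover have "\<theta> (Min ?L) \<le> \<theta> j" "\<theta> j \<le> \<theta> (Max ?L)"
        by (rule isotone_coneD[OF assms(1)]; use j M calculation in simp)+
      ultimately show "j \<in> ?L" using M by auto
    qed
  qed
qed

text \<open>Level sets of an isotone vector are intervals, hence constant runs, and every constant
  run lies in the level set of each of its points. The maximal runs are therefore exactly the level
  sets, which makes them a finite partition of the indices.\<close>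

lemma constant_blocks_eq_level_sets:
  assumes \<theta>: "\<theta> \<in> isotone_cone n"
  shows "constant_blocks n \<theta> = (\<lambda>i. {j\<in>{1..n}. \<theta> j = \<theta> i}) ` {1..n}"
proof -
  let ?L = "\<lambda>i. {j\<in>{1..n}. \<theta> j = \<theta> i}"
  have run: "constant_run n \<theta> (?L i)" if i: "i \<in> {1..n}" for i
  proof -
    obtain a b where "1 \<le> a" "a \<le> i" "i \<le> b" "b \<le> n" and L: "?L i = {a..b}"
      using level_set_interval[OF \<theta> i] .
    then have "\<exists>a b. 1 \<le> a \<and> a \<le> b \<and> b \<le> n \<and> ?L i = {a..b}" by (meson order_trans)
    then show ?thesis unfolding constant_run_def by auto
  qed
  have sub: "B \<subseteq> ?L i" if "constant_run n \<theta> B" "i \<in> B" for B i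
    using that unfolding constant_run_def by fastforce
  show ?thesis
  proof (intro equalityI subsetI)
    fix B assume "B \<in> constant_blocks n \<theta>"
    then have B: "constant_run n \<theta> B" "\<And>B'. constant_run n \<theta> B' \<Longrightarrow> B \<subseteq> B' \<Longrightarrow> B' = B"
      unfolding constant_blocks_def by auto
    obtain i where i: "i \<in> B" using B(1) unfolding constant_run_def by fastforce
    then have "i \<in> {1..n}" using sub[OF B(1) i] by auto
    then show "B \<in> ?L ` {1..n}" using B(2)[OF run sub[OF B(1) i]] by blast
  next
    fix B assume "B \<in> ?L ` {1..n}"
    then obtain i where i: "i \<in> {1..n}" "B = ?L i" by blast
    have "B' = B" if "constant_run n \<theta> B'" "B \<subseteq> B'" for B'
      using sub[OF that(1), of i] that(2) i by blast
    then show "B \<in> constant_blocks n \<theta>" unfolding constant_blocks_def using run i by blast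
  qed
qed

lemma sum_constant_blocks:
  assumes \<theta>: "\<theta> \<in> isotone_cone n"
  shows "(\<Sum>B\<in>constant_blocks n \<theta>. \<Sum>i\<in>B. f i) = (\<Sum>i=1..n. f i)"
proof -
  let ?L = "\<lambda>i. {j\<in>{1..n}. \<theta> j = \<theta> i}"
  have "(\<Sum>i=1..n. f i) = (\<Sum>B\<in>?L ` {1..n}. \<Sum>i\<in>{i\<in>{1..n}. ?L i = B}. f i)"
    by (rule sum.image_gen) simp
  \<comment> \<open>The indices whose level set is \<open>B\<close> are precisely the elements of
    \<open>B\<close>.\<close>
  also have "\<dots> = (\<Sum>B\<in>?L ` {1..n}. \<Sum>i\<in>B. f i)"
    by (intro sum.cong refl) auto
  finally show ?thesis by (simp add: constant_blocks_eq_level_sets[OF \<theta>])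
qed

lemma constant_block_interval:
  assumes "B \<in> constant_blocks n \<theta>"
  obtains a b where "1 \<le> a" "a \<le> b" "b \<le> n" "B = {a..b}" "\<theta> a = \<theta> b"
  using assms unfolding constant_blocks_def constant_run_def by fastforce

lemma isotonic_risk_eq_sum_coordinates:
  "isotonic_risk p n \<sigma> \<theta> = ennreal (1 / real n) * (\<Sum>i=1..n.
     \<integral>\<^sup>+ \<epsilon>. ennreal (\<bar>isotonic_lse n (\<lambda>j\<in>{1..n}. \<theta> j + \<epsilon> j) i - \<theta> i\<bar> powr p) \<partial>gaussian_noise n \<sigma>)"
proof -
  let ?P = "\<Pi>\<^sub>M j\<in>{1..n}. (borel :: real measure)"
  have "(\<lambda>\<epsilon>. \<lambda>j\<in>{1..n}. \<theta> j + \<epsilon> j) \<in> gaussian_noise n \<sigma> \<rightarrow>\<^sub>M ?P"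
    unfolding measurable_cong_sets[OF sets_gaussian_noise refl] by measurable
  then have "(\<lambda>\<epsilon>. ennreal (\<bar>isotonic_lse n (\<lambda>j\<in>{1..n}. \<theta> j + \<epsilon> j) i - \<theta> i\<bar> powr p))
      \<in> borel_measurable (gaussian_noise n \<sigma>)" if "i \<in> {1..n}" for i
    by (intro measurable_compose[OF _ measurable_ennreal] powr_real_measurable borel_measurable_abs
        borel_measurable_diff measurable_compose[OF _ measurable_isotonic_lse[OF that]]) auto
  then show ?thesis
    unfolding isotonic_risk_def
    by (subst nn_integral_sum[symmetric]) (simp_all add: sum_ennreal)
qed

lemma card_constant_blocks_pos:
  assumes "\<theta> \<in> isotone_cone n" "1 \<le> n"
  shows "0 < card (constant_blocks n \<theta>)"
  using assms by (subst constant_blocks_eq_level_sets) (auto simp: card_gt_0_iff)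

text \<open>Jensen's inequality for the concave function \<open>x powr \<alpha>\<close>, derived by
  applying Young's inequality to each \<open>f x\<close> and the mean \<open>s / k\<close>.\<close>

lemma sum_powr_le_card_powr:
  fixes \<alpha> :: real
  assumes "finite A" "A \<noteq> {}" "\<And>x. x \<in> A \<Longrightarrow> 0 < f x" "0 \<le> \<alpha>" "\<alpha> \<le> 1"
  shows "(\<Sum>x\<in>A. f x powr \<alpha>) \<le> real (card A) powr (1 - \<alpha>) * (\<Sum>x\<in>A. f x) powr \<alpha>"
proof -
  define k where "k = real (card A)"
  define s where "s = (\<Sum>x\<in>A. f x)"
  have k: "k > 0" using assms by (simp add: k_def card_gt_0_iff)
  have s: "s > 0" unfolding s_def using assms by (intro sum_pos) auto
  have "(\<Sum>x\<in>A. f x powr \<alpha> * (s / k) powr (1 - \<alpha>)) \<le> (\<Sum>x\<in>A. \<alpha> * f x + (1 - \<alpha>) * (s / k))"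
    using assms k s by (intro sum_mono Youngs_inequality_0) auto
  also have "\<dots> = \<alpha> * s + (1 - \<alpha>) * s"
    using k by (simp add: sum.distrib k_def flip: sum_distrib_left s_def)
  also have "\<dots> = s" by (simp add: algebra_simps)
  finally have "(\<Sum>x\<in>A. f x powr \<alpha>) * (s / k) powr (1 - \<alpha>) \<le> s" by (simp add: sum_distrib_right)
  then have "(\<Sum>x\<in>A. f x powr \<alpha>) \<le> s / (s / k) powr (1 - \<alpha>)" using s k by (simp add: field_simps)
  also have "\<dots> = k powr (1 - \<alpha>) * s powr \<alpha>"
    using s k by (simp add: powr_divide powr_diff)
  finally show ?thesis by (simp add: k_def s_def)
qed

text \<open>The block lengths add up to \<open>n\<close>, and the exponents
  \<open>max (2 - p) 0 / 2\<close> and \<open>min p 2 / 2\<close> add up to 1, so the concavity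
  bound rearranges into the claim.\<close>

lemma sum_block_card_powr_le:
  fixes p :: real
  assumes \<theta>: "\<theta> \<in> isotone_cone n" and n: "1 \<le> n" and p: "0 \<le> p"
  shows "(\<Sum>B\<in>constant_blocks n \<theta>. real (card B) powr (max (2 - p) 0 / 2))
    \<le> real n * (real (card (constant_blocks n \<theta>)) / real n) powr (min p 2 / 2)"
proof -
  let ?S = "constant_blocks n \<theta>"
  define \<alpha> where "\<alpha> = max (2 - p) 0 / 2"
  have \<alpha>: "0 \<le> \<alpha>" "\<alpha> \<le> 1" "min p 2 / 2 = 1 - \<alpha>" using p by (auto simp: \<alpha>_def max_def min_def field_simps)
  have k: "0 < card ?S" by (rule card_constant_blocks_pos[OF \<theta> n])
  have "(\<Sum>B\<in>?S. real (card B) powr \<alpha>) \<le> real (card ?S) powr (1 - \<alpha>) * (\<Sum>B\<in>?S. real (card B)) powr \<alpha>"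
    using k \<alpha> by (intro sum_powr_le_card_powr) (auto simp: card_gt_0_iff elim: constant_block_interval)
  also have "(\<Sum>B\<in>?S. real (card B)) = real n"
    using sum_constant_blocks[OF \<theta>, of "\<lambda>_. 1::real"] by simp
  also have "real (card ?S) powr (1 - \<alpha>) * real n powr \<alpha> = real n * (real (card ?S) / real n) powr (1 - \<alpha>)"
    using n k by (simp add: powr_divide powr_diff)
  finally show ?thesis unfolding \<alpha>(3) \<alpha>_def[symmetric] .
qed

theorem theorem2p2:
  fixes p :: real
  assumes "p \<ge> 1" and "p \<noteq> 2"
  shows "\<exists>C>0. \<forall>n\<ge>1. \<forall>\<sigma>>0. \<forall>\<theta>\<in>isotone_cone n.
      isotonic_risk p n \<sigma> \<theta>
        \<le> ennreal (C * (\<sigma> powr p / real n) *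
            (\<Sum>B\<in>constant_blocks n \<theta>. real (card B) powr (max (2 - p) 0 / 2)))
    \<and> C * (\<sigma> powr p / real n) *
            (\<Sum>B\<in>constant_blocks n \<theta>. real (card B) powr (max (2 - p) 0 / 2))
        \<le> C * \<sigma> powr p *
            (real (card (constant_blocks n \<theta>)) / real n) powr (min p 2 / 2)"
proof -
  have p: "0 \<le> p" "0 < p" using assms by auto
  obtain D where D: "D > 0" and risk: "\<And>n \<sigma> \<theta> a i b. 0 < \<sigma> \<Longrightarrow> \<theta> \<in> isotone_cone n \<Longrightarrow>
    1 \<le> a \<Longrightarrow> a \<le> i \<Longrightarrow> i \<le> b \<Longrightarrow> b \<le> n \<Longrightarrow> \<theta> a = \<theta> b \<Longrightarrow>
    (\<integral>\<^sup>+ \<epsilon>. ennreal (\<bar>isotonic_lse n (\<lambda>j\<in>{1..n}. \<theta> j + \<epsilon> j) i - \<theta> i\<bar> powr p) \<partial>gaussian_noise n \<sigma>)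
      \<le> ennreal (D * \<sigma> powr p * (real (b + 1 - i) powr (- p / 2) + real (i + 1 - a) powr (- p / 2)))"
    using isotonic_lse_coordinate_risk[OF p(1)] by blast
  obtain A where A: "A > 0"
    and sum_le: "\<And>N. (\<Sum>m=1..N. real m powr (- p / 2)) \<le> A * real N powr (max (2 - p) 0 / 2)"
    using sum_neg_powr_half_le[OF p(2) assms(2)] by blast
  \<comment> \<open>\<open>D\<close> bounds a single coordinate, \<open>A\<close> sums these bounds
    over a block, and the 2 accounts for the two ends of the block.\<close>
  define C where "C = 2 * A * D"
  have C: "C > 0" using A D by (simp add: C_def)
  have "isotonic_risk p n \<sigma> \<theta>
        \<le> ennreal (C * (\<sigma> powr p / real n) *
            (\<Sum>B\<in>constant_blocks n \<theta>. real (card B) powr (max (2 - p) 0 / 2)))"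
    if n: "1 \<le> n" and \<sigma>: "0 < \<sigma>" and \<theta>: "\<theta> \<in> isotone_cone n" for n \<sigma> \<theta>
  proof -
    let ?S = "constant_blocks n \<theta>" and ?e = "max (2 - p) 0 / 2"
    let ?R = "\<lambda>i. \<integral>\<^sup>+ \<epsilon>. ennreal (\<bar>isotonic_lse n (\<lambda>j\<in>{1..n}. \<theta> j + \<epsilon> j) i - \<theta> i\<bar> powr p)
      \<partial>gaussian_noise n \<sigma>"
    have block: "(\<Sum>i\<in>B. ?R i) \<le> ennreal (C * \<sigma> powr p * real (card B) powr ?e)" if B: "B \<in> ?S" for B
    proof -
      obtain a b where ab: "1 \<le> a" "a \<le> b" "b \<le> n" "B = {a..b}" "\<theta> a = \<theta> b"
        using constant_block_interval[OF B] .
      have "(\<Sum>i\<in>B. ?R i)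
          \<le> (\<Sum>i=a..b. ennreal (D * \<sigma> powr p * (real (b + 1 - i) powr (- p / 2) + real (i + 1 - a) powr (- p / 2))))"
        unfolding ab(4) by (intro sum_mono risk[OF \<sigma> \<theta>]) (use ab in auto)
      also have "\<dots> = ennreal (\<Sum>i=a..b. D * \<sigma> powr p * (real (b + 1 - i) powr (- p / 2) + real (i + 1 - a) powr (- p / 2)))"
        using D by (intro sum_ennreal) auto
      also have "(\<Sum>i=a..b. D * \<sigma> powr p * (real (b + 1 - i) powr (- p / 2) + real (i + 1 - a) powr (- p / 2)))
          = D * \<sigma> powr p * ((\<Sum>i=a..b. real (b + 1 - i) powr (- p / 2)) + (\<Sum>i=a..b. real (i + 1 - a) powr (- p / 2)))"
        by (simp only: sum.distrib flip: sum_distrib_left)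
      \<comment> \<open>Counting from the right end or from the left end of the block, the distances
        run through the same values \<open>1..card B\<close>.\<close>
      also have "(\<Sum>i=a..b. real (b + 1 - i) powr (- p / 2)) = (\<Sum>m=1..card B. real m powr (- p / 2))"
        unfolding ab(4)
        by (rule sum.reindex_bij_witness[of _ "\<lambda>m. b + 1 - m" "\<lambda>i. b + 1 - i"]) auto
      also have "(\<Sum>i=a..b. real (i + 1 - a) powr (- p / 2)) = (\<Sum>m=1..card B. real m powr (- p / 2))"
        unfolding ab(4)
        by (rule sum.reindex_bij_witness[of _ "\<lambda>m. m + a - 1" "\<lambda>i. i + 1 - a"]) (use ab in auto)
      also have "ennreal (D * \<sigma> powr p *
          ((\<Sum>m=1..card B. real m powr (- p / 2)) + (\<Sum>m=1..card B. real m powr (- p / 2))))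
          \<le> ennreal (D * \<sigma> powr p * (A * real (card B) powr ?e + A * real (card B) powr ?e))"
        using D by (intro ennreal_leI mult_left_mono add_mono sum_le) auto
      also have "D * \<sigma> powr p * (A * real (card B) powr ?e + A * real (card B) powr ?e)
          = C * \<sigma> powr p * real (card B) powr ?e"
        by (simp add: C_def)
      finally show ?thesis .
    qed
    have "isotonic_risk p n \<sigma> \<theta> = ennreal (1 / real n) * (\<Sum>B\<in>?S. \<Sum>i\<in>B. ?R i)"
      unfolding isotonic_risk_eq_sum_coordinates sum_constant_blocks[OF \<theta>] ..
    also have "\<dots> \<le> ennreal (1 / real n) * (\<Sum>B\<in>?S. ennreal (C * \<sigma> powr p * real (card B) powr ?e))"
      by (intro mult_left_mono sum_mono block) auto
    also have "\<dots> = ennreal (1 / real n * (\<Sum>B\<in>?S. C * \<sigma> powr p * real (card B) powr ?e))"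
    proof -
      have "(\<Sum>B\<in>?S. ennreal (C * \<sigma> powr p * real (card B) powr ?e))
          = ennreal (\<Sum>B\<in>?S. C * \<sigma> powr p * real (card B) powr ?e)"
        using C by (intro sum_ennreal) auto
      then show ?thesis using C by (simp only:) (intro ennreal_mult[symmetric] sum_nonneg, auto)
    qed
    also have "1 / real n * (\<Sum>B\<in>?S. C * \<sigma> powr p * real (card B) powr ?e)
        = C * (\<sigma> powr p / real n) * (\<Sum>B\<in>?S. real (card B) powr ?e)"
      by (simp flip: sum_distrib_left)
    finally show ?thesis .
  qed
  moreover have "C * (\<sigma> powr p / real n) *
            (\<Sum>B\<in>constant_blocks n \<theta>. real (card B) powr (max (2 - p) 0 / 2))
        \<le> C * \<sigma> powr p *
            (real (card (constant_blocks n \<theta>)) / real n) powr (min p 2 / 2)"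
    if n: "1 \<le> n" and \<theta>: "\<theta> \<in> isotone_cone n" for n \<sigma> \<theta>
  proof -
    have "C * (\<sigma> powr p / real n) *
            (\<Sum>B\<in>constant_blocks n \<theta>. real (card B) powr (max (2 - p) 0 / 2))
        \<le> C * (\<sigma> powr p / real n) *
            (real n * (real (card (constant_blocks n \<theta>)) / real n) powr (min p 2 / 2))"
      using C by (intro mult_left_mono sum_block_card_powr_le[OF \<theta> n p(1)]) auto
    then show ?thesis using n by simp
  qed
  ultimately show ?thesis using C by blast
qed

end
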